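(* Let $X_1,\dots,X_n\subset\mathbb{R}^d$ be compact and let $\mu_i\in\mathcal{P}(X_i)$ satisfy $\mu_1\preceq_c\dots\preceq_c\mu_n$. For each $i=1,\dots,n-1$, let $c_i:X_i\times X_{i+1}\to\mathbb{R}$ be continuous and let $\pi^*_{i,i+1}\in\Pi_M(\mu_i,\mu_{i+1})$ be optimal for the two-period martingale optimal transport problem with cost $c_i$, i.e. a minimizer of $\int c_i\,d\pi$ over $\pi\in\Pi_M(\mu_i,\mu_{i+1})$. Then any coupling $\pi^*\in\Pi_M(\mu_1,\dots,\mu_n)$ obtained by gluing the $\pi^*_{i,i+1}$, that is, any $\pi^*\in\Pi_M(\mu_1,\dots,\mu_n)$ with $\mathrm{Proj}_{i,i+1}(\pi^* )=\pi^*_{i,i+1}$ for all $i=1,\dots,n-1$, is optimal for the multi-period martingale optimal transport problem (minimize $\int c\,d\pi$ over $\pi\in\Pi_M(\mu_1,\dots,\mu_n)$) with cost $$c(x_1,\dots,x_n)=\sum_{i=1}^{n-1}c_i(x_i,x_{i+1}).$$ Conversely, if $\pi\in\Pi_M(\mu_1,\dots,\mu_n)$ is optimal for the multi-period problem with this cost, then each twofold projection $\mathrm{Proj}_{i,i+1}(\pi)$ is optimal for the corresponding two-period problem with cost $c_i$ between $\mu_i$ and $\mu_{i+1}$.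
   Context: $\mathcal{P}(X)$ is the set of Borel probability measures on $X$. Convex order: $\mu\preceq_c\nu$ means $\int\varphi\,d\mu\le\int\varphi\,d\nu$ for all convex $\varphi:\mathbb{R}^d\to\mathbb{R}$. $\Pi(\mu_1,\dots,\mu_n)$ is the set of probability measures on $X_1\times\dots\times X_n$ with $i$-th marginal $\mu_i$. $\mathrm{Proj}_I(\pi)$ is the marginal of $\pi$ on the coordinates indexed by $I$. $\mu\otimes\kappa$ denotes the joint measure with marginal $\mu$ and conditional probability kernel $\kappa$. Martingale couplings: $\Pi_M(\mu_1,\dots,\mu_n)$ is the set of $\pi\in\Pi(\mu_1,\dots,\mu_n)$ such that for each $i=1,\dots,n-1$, disintegrating $\pi=\mathrm{Proj}_{1\dots i}(\pi)\otimes\kappa_{1\dots i}^{i+1,\dots,n}$, one has $\int x_{i+1}\,\kappa_{1\dots i}^{i+1,\dots,n}(x_1,\dots,x_i,dx_{i+1},\dots,dx_n)=x_i$ for $\mathrm{Proj}_{1\dots i}(\pi)$-almost every $(x_1,\dots,x_i)$. *)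

theory Defs
  imports "HOL-Probability.Probability"
begin

text \<open>
  A path \<open>(x\<^sub>m, \<dots>, x\<^sub>n)\<close> is a function on the index set \<open>{m..n}\<close>, and \<open>X\<^sub>m \<times> \<dots> \<times> X\<^sub>n\<close> is the
  extensional product over that set. Two-period problems are the case \<open>n = Suc m\<close>, so that
  the pair \<open>(x\<^sub>i, x\<^sub>i\<^sub>+\<^sub>1)\<close> keeps its original indices \<open>i\<close> and \<open>Suc i\<close>. The Borel probability
  measures on \<open>X\<close> are the points of \<open>prob_algebra (borel_on X)\<close>.
\<close>

abbreviation borel_on :: "'a::topological_space set \<Rightarrow> 'a measure" where
  "borel_on X \<equiv> restrict_space borel X"

abbreviation path_space :: "nat set \<Rightarrow> (nat \<Rightarrow> 'a::topological_space set) \<Rightarrow> (nat \<Rightarrow> 'a) measure" where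
  "path_space I X \<equiv> PiM I (\<lambda>i. borel_on (X i))"

text \<open>
  For the compactly supported measures considered here every (automatically continuous) convex
  function is integrable, so the convention that a non-integrable function has Bochner integral
  \<open>0\<close> plays no role.
\<close>

definition convex_order :: "'a::euclidean_space measure \<Rightarrow> 'a measure \<Rightarrow> bool"  (infix "\<preceq>\<^sub>c" 50) where
  "\<mu> \<preceq>\<^sub>c \<nu> \<longleftrightarrow>
    (\<forall>\<phi>::'a \<Rightarrow> real. convex_on UNIV \<phi> \<longrightarrow> integral\<^sup>L \<mu> \<phi> \<le> integral\<^sup>L \<nu> \<phi>)"

definition couplings ::
  "nat \<Rightarrow> nat \<Rightarrow> (nat \<Rightarrow> 'a::euclidean_space set) \<Rightarrow> (nat \<Rightarrow> 'a measure) \<Rightarrow> (nat \<Rightarrow> 'a) measure set" where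
  "couplings m n X \<mu> =
    {\<pi> \<in> space (prob_algebra (path_space {m..n} X)).
      \<forall>i\<in>{m..n}. distr \<pi> (borel_on (X i)) (\<lambda>x. x i) = \<mu> i}"

definition Proj ::
  "nat set \<Rightarrow> (nat \<Rightarrow> 'a::euclidean_space set) \<Rightarrow> (nat \<Rightarrow> 'a) measure \<Rightarrow> (nat \<Rightarrow> 'a) measure" where
  "Proj I X \<pi> = distr \<pi> (path_space I X) (\<lambda>x. restrict x I)"

text \<open>
  The measure \<open>\<nu> \<otimes> \<kappa>\<close>, where \<open>\<nu>\<close> lives on the coordinates \<open>{m..i}\<close> and the kernel \<open>\<kappa>\<close> takes
  values in the measures on the coordinates \<open>{Suc i..n}\<close>.
\<close>

definition semidirect ::
  "nat \<Rightarrow> nat \<Rightarrow> nat \<Rightarrow> (nat \<Rightarrow> 'a::euclidean_space set) \<Rightarrow> (nat \<Rightarrow> 'a) measure \<Rightarrow>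
    ((nat \<Rightarrow> 'a) \<Rightarrow> (nat \<Rightarrow> 'a) measure) \<Rightarrow> (nat \<Rightarrow> 'a) measure" where
  "semidirect m i n X \<nu> \<kappa> =
    \<nu> \<bind> (\<lambda>x. distr (\<kappa> x) (path_space {m..n} X) (\<lambda>y. merge {m..i} {Suc i..n} (x, y)))"

text \<open>
  Disintegrations on these spaces exist and are almost everywhere unique, so it does not matter
  whether the barycentre condition is imposed on some or on every disintegration kernel.
\<close>

definition martingale_couplings ::
  "nat \<Rightarrow> nat \<Rightarrow> (nat \<Rightarrow> 'a::euclidean_space set) \<Rightarrow> (nat \<Rightarrow> 'a measure) \<Rightarrow> (nat \<Rightarrow> 'a) measure set" where
  "martingale_couplings m n X \<mu> =
    {\<pi> \<in> couplings m n X \<mu>.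
      \<forall>i\<in>{m..<n}. \<exists>\<kappa> \<in> path_space {m..i} X \<rightarrow>\<^sub>M prob_algebra (path_space {Suc i..n} X).
        \<pi> = semidirect m i n X (Proj {m..i} X \<pi>) \<kappa> \<and>
        (AE x in Proj {m..i} X \<pi>. (LINT y|\<kappa> x. y (Suc i)) = x i)}"

definition mot_optimal ::
  "nat \<Rightarrow> nat \<Rightarrow> (nat \<Rightarrow> 'a::euclidean_space set) \<Rightarrow> (nat \<Rightarrow> 'a measure) \<Rightarrow> ((nat \<Rightarrow> 'a) \<Rightarrow> real) \<Rightarrow>
    (nat \<Rightarrow> 'a) measure \<Rightarrow> bool" where
  "mot_optimal m n X \<mu> c \<pi> \<longleftrightarrow>
    \<pi> \<in> martingale_couplings m n X \<mu> \<and>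
    (\<forall>\<rho>\<in>martingale_couplings m n X \<mu>. (LINT x|\<pi>. c x) \<le> (LINT x|\<rho>. c x))"

end

theory Submission
  imports Defs
begin

text \<open>
  A coupling \<open>\<pi>\<close> is a martingale coupling iff the integral of \<open>w(x\<^sub>m, \<dots>, x\<^sub>i) (x\<^sub>i\<^sub>+\<^sub>1 - x\<^sub>i)\<close> vanishes for
  all \<open>i\<close> and all bounded measurable \<open>w\<close>; the nontrivial direction needs disintegration. In this
  form, martingale couplings are stable under projection to a block of consecutive times. They are also
  stable under gluing at a common time \<open>k\<close>: take the second coupling \<open>\<tau>\<close> and attach the past
  by the backward kernel of the first coupling given \<open>x\<^sub>k\<close>; after time \<open>k\<close>, integrating out the past
  turns a test function of \<open>(x\<^sub>a, \<dots>, x\<^sub>i)\<close> into one of \<open>(x\<^sub>k, \<dots>, x\<^sub>i)\<close>, for which \<open>\<tau>\<close> is a martingale.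
  The total cost depends only on the twofold projections, which are feasible for the two-period problems,
  so optimality of these gives optimality of \<open>\<pi>\<close>. Conversely, gluing allows one to replace a
  twofold projection by an arbitrary competitor while keeping all others.
\<close>

section \<open>Disintegration\<close>

text \<open>
  With digits \<open>0\<close> and \<open>1\<close> only, the expansion in base 3 is unique, so that all digits can be recovered.
\<close>

definition ternary :: "(nat \<Rightarrow> bool) \<Rightarrow> real" where
  "ternary b = (\<Sum>k. of_bool (b k) * (1/3) ^ Suc k)"

lemma summable_ternary: "summable (\<lambda>k. of_bool (b k) * (1/3 :: real) ^ Suc k)"
  by (rule summable_comparison_test'[where g="\<lambda>k. (1/3 :: real) ^ k" and N=0])
    (auto simp: summable_geometric_iff)

lemma ternary_nonneg: "0 \<le> ternary b"
  unfolding ternary_def by (intro suminf_nonneg summable_ternary) auto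

text \<open>Since this bound is below 1, the tail in \<open>ternary_shift\<close> never carries into
  the leading digit.\<close>

lemma ternary_le_half: "ternary b \<le> 1/2"
proof -
  have s: "(\<lambda>k. (1/3 :: real) ^ Suc k) sums (1/2)"
    using sums_mult[OF geometric_sums[of "1/3 :: real"], of "1/3"] by simp
  have "ternary b \<le> (\<Sum>k. (1/3 :: real) ^ Suc k)"
    unfolding ternary_def using s
    by (intro suminf_le summable_ternary) (auto simp: sums_iff)
  then show ?thesis using s by (simp add: sums_iff)
qed

lemma ternary_shift: "3 * ternary b = of_bool (b 0) + ternary (\<lambda>k. b (Suc k))"
proof -
  have "ternary b = of_bool (b 0) / 3 + (\<Sum>k. (1/3) * (of_bool (b (Suc k)) * (1/3) ^ Suc k))"
    using suminf_split_head[OF summable_ternary[of b]] unfolding ternary_def by (simp add: mult_ac)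
  also have "(\<Sum>k. (1/3) * (of_bool (b (Suc k)) * (1/3 :: real) ^ Suc k)) = (1/3) * ternary (\<lambda>k. b (Suc k))"
    unfolding ternary_def by (rule suminf_mult[OF summable_ternary])
  finally show ?thesis by simp
qed

text \<open>Multiplying by 3 shifts the expansion by one place. In the induction step the leading
  digit contributes a multiple of 3, which vanishes modulo 3.\<close>

lemma ternary_digit: "\<lfloor>3 ^ Suc k * ternary b\<rfloor> mod 3 = of_bool (b k)"
proof (induction k arbitrary: b)
  case 0
  have "\<lfloor>3 * ternary b\<rfloor> = of_bool (b 0)"
    using ternary_nonneg[of "\<lambda>k. b (Suc k)"] ternary_le_half[of "\<lambda>k. b (Suc k)"]
    unfolding ternary_shift by (intro floor_unique) auto
  then show ?case by simp
next
  case (Suc k)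
  have "3 ^ Suc (Suc k) * ternary b = 3 ^ Suc k * (3 * ternary b)"
    by simp
  also have "\<dots> = of_int (3 * (3 ^ k * of_bool (b 0))) + 3 ^ Suc k * ternary (\<lambda>k. b (Suc k))"
    unfolding ternary_shift by (simp add: algebra_simps)
  finally have "\<lfloor>3 ^ Suc (Suc k) * ternary b\<rfloor>
      = 3 * (3 ^ k * of_bool (b 0)) + \<lfloor>3 ^ Suc k * ternary (\<lambda>k. b (Suc k))\<rfloor>"
    by (metis floor_add_int add.commute)
  then show ?case using Suc.IH[of "\<lambda>k. b (Suc k)"] by simp
qed

text \<open>A point is determined by the answers to countably many questions: is the dense point
  \<open>d j\<close> within \<open>(1/2) ^ m\<close> of it? These answers are the digits of
  \<open>g x\<close>. A measurable left inverse is all that disintegration needs, so the range of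
  \<open>g\<close> is left unspecified.\<close>

lemma polish_real_encoding:
  obtains g :: "'a::polish_space \<Rightarrow> real" and h
  where "g \<in> borel_measurable borel" "h \<in> borel_measurable borel"
    "\<And>x. h (g x) = x" "\<And>x. 0 \<le> g x \<and> g x \<le> 1"
proof -
  obtain D :: "'a set" where D: "countable D" "\<And>U. open U \<Longrightarrow> U \<noteq> {} \<Longrightarrow> \<exists>d\<in>D. d \<in> U"
    using countable_dense_setE by blast
  then have "D \<noteq> {}" using open_UNIV by blast
  define d where "d = from_nat_into D"
  have near: "\<exists>j. dist x (d j) < e" if "e > 0" for x e
  proof -
    have "\<exists>y\<in>D. y \<in> ball x e" using that by (intro D(2)) auto
    then show ?thesis using from_nat_into_surj[OF D(1)] unfolding d_def by (metis mem_ball)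
  qed
  \<comment> \<open>\<open>prod_decode k\<close> is read as a pair: the index of a dense point and
    an accuracy level.\<close>
  define bit where "bit x k = (dist x (d (fst (prod_decode k))) < (1/2) ^ snd (prod_decode k))" for x k
  define g where "g x = ternary (bit x)" for x
  \<comment> \<open>The decoder at level \<open>m\<close> picks the first dense point whose digit at
    that level is 1. For \<open>r = g x\<close> this point lies within \<open>(1/2) ^ m\<close> of
    \<open>x\<close>.\<close>
  define hm where "hm m r = d (LEAST j. \<lfloor>3 ^ Suc (prod_encode (j, m)) * r\<rfloor> mod 3 = 1)"
    for m and r :: real
  \<comment> \<open>For \<open>r\<close> outside the range of \<open>g\<close> the points
    \<open>hm m r\<close> may fail to converge. Replacing them by a constant in that case makes the
    limit exist for every real \<open>r\<close>, so that it is measurable as a pointwise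
    limit.\<close>
  define f where "f m r = (if Cauchy (\<lambda>m. hm m r) then hm m r else d 0)" for m r
  have hm: "dist x (hm m (g x)) < (1/2) ^ m" for m x
  proof -
    have eq: "hm m (g x) = d (LEAST j. dist x (d j) < (1/2) ^ m)"
      unfolding hm_def g_def ternary_digit by (simp add: bit_def)
    show ?thesis unfolding eq by (rule LeastI_ex) (rule near, simp)
  qed
  have hm_lim: "(\<lambda>m. hm m (g x)) \<longlonglongrightarrow> x" for x
  proof (rule metric_LIMSEQ_I)
    fix e :: real assume "e > 0"
    then obtain N where N: "(1/2) ^ N < e" using real_arch_pow_inv[of e "1/2"] by auto
    have "dist (hm n (g x)) x < e" if "n \<ge> N" for n
    proof -
      have "dist (hm n (g x)) x < (1/2) ^ n" using hm[of x n] by (simp add: dist_commute)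
      also have "\<dots> \<le> (1/2) ^ N" using that by (intro power_decreasing) auto
      finally show ?thesis using N by simp
    qed
    then show "\<exists>N. \<forall>n\<ge>N. dist (hm n (g x)) x < e" by blast
  qed
  have "convergent (\<lambda>m. f m r)" for r
    unfolding f_def by (cases "Cauchy (\<lambda>m. hm m r)") (auto simp: Cauchy_convergent convergent_const)
  then have f_lim: "(\<lambda>m. f m r) \<longlonglongrightarrow> lim (\<lambda>m. f m r)" for r
    by (simp add: convergent_LIMSEQ_iff)
  have [measurable]: "hm m \<in> borel_measurable borel" for m
    unfolding hm_def by measurable
  have [measurable]: "f m \<in> borel_measurable borel" for m
    unfolding f_def by measurable
  show ?thesis
  proof
    show "g \<in> borel_measurable borel"
      unfolding g_def ternary_def bit_def by measurable
    show "(\<lambda>r. lim (\<lambda>m. f m r)) \<in> borel_measurable borel"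
      by (rule borel_measurable_LIMSEQ_metric[where f=f]) (auto intro: f_lim)
    show "lim (\<lambda>m. f m (g x)) = x" for x
      using hm_lim[of x] LIMSEQ_imp_Cauchy[OF hm_lim[of x]] unfolding f_def by (simp add: limI)
    show "0 \<le> g x \<and> g x \<le> 1" for x
      using ternary_nonneg[of "bit x"] ternary_le_half[of "bit x"] by (simp add: g_def)
  qed
qed

section \<open>Conditional laws of a variable in the unit interval\<close>

text \<open>Otherwise \<open>g < f\<close> on a set \<open>D\<close> of positive measure. The
  integral of \<open>g\<close> over \<open>D\<close> is finite because that of \<open>f\<close> is,
  so the integral of \<open>f\<close> over \<open>D\<close> is strictly larger.\<close>

lemma AE_le_of_set_nn_integral_le:
  fixes f g :: "'a \<Rightarrow> ennreal"
  assumes [measurable]: "f \<in> borel_measurable M" "g \<in> borel_measurable M"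
    and le: "\<And>A. A \<in> sets M \<Longrightarrow> (\<integral>\<^sup>+x\<in>A. f x \<partial>M) \<le> (\<integral>\<^sup>+x\<in>A. g x \<partial>M)"
    and fin: "(\<integral>\<^sup>+x. f x \<partial>M) \<noteq> \<infinity>"
  shows "AE x in M. f x \<le> g x"
proof (rule ccontr)
  define D where "D = {x\<in>space M. g x < f x}"
  have [measurable]: "D \<in> sets M" unfolding D_def by measurable
  assume "\<not> (AE x in M. f x \<le> g x)"
  moreover have "AE x in M. f x \<le> g x" if "AE x in M. f x * indicator D x \<le> g x * indicator D x"
    using that AE_space
  proof eventually_elim
    case (elim x)
    then show ?case by (cases "g x < f x") (auto simp: D_def)
  qed
  ultimately have n: "\<not> (AE x in M. f x * indicator D x \<le> g x * indicator D x)" by blast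
  have "(\<integral>\<^sup>+x\<in>D. g x \<partial>M) \<le> (\<integral>\<^sup>+x. f x \<partial>M)"
    by (intro nn_integral_mono) (auto simp: D_def indicator_def)
  then have "(\<integral>\<^sup>+x\<in>D. g x \<partial>M) \<noteq> \<infinity>" using fin by (auto simp: top_unique)
  then have "(\<integral>\<^sup>+x\<in>D. g x \<partial>M) < (\<integral>\<^sup>+x\<in>D. f x \<partial>M)"
    by (intro nn_integral_less n) (auto simp: D_def indicator_def)
  with le[of D] show False by simp
qed

text \<open>\<open>q n\<close> is the least multiple of \<open>1 / 2 ^ n\<close> strictly above
  \<open>t\<close>. The dyadic grids are nested, so the sequence decreases, and \<open>t < 1\<close>
  makes its first term at most 1.\<close>

lemma decreasing_rationals:
  fixes t :: real
  assumes "0 \<le> t" "t < 1"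
  obtains q where "decseq q" "\<And>n. q n \<in> {0..1} \<inter> \<rat>" "\<And>n. t < q n" "q \<longlonglongrightarrow> t"
proof
  define q where "q n = (of_int \<lfloor>2 ^ n * t\<rfloor> + 1) / (2 :: real) ^ n" for n :: nat
  have gt: "t < q n" for n
    unfolding q_def by (simp add: field_simps) linarith
  have le: "q n \<le> t + (1/2) ^ n" for n
    unfolding q_def by (simp add: field_simps power_divide)
  have "q (Suc n) \<le> q n" for n
  proof -
    have "2 ^ Suc n * t < of_int (2 * (\<lfloor>2 ^ n * t\<rfloor> + 1))"
      by simp linarith
    then have "\<lfloor>2 ^ Suc n * t\<rfloor> < 2 * (\<lfloor>2 ^ n * t\<rfloor> + 1)"
      by (simp only: floor_less_iff)
    then have "of_int (\<lfloor>2 ^ Suc n * t\<rfloor> + 1) \<le> (of_int (2 * (\<lfloor>2 ^ n * t\<rfloor> + 1)) :: real)"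
      by (simp only: of_int_le_iff)
    then have "q (Suc n) \<le> of_int (2 * (\<lfloor>2 ^ n * t\<rfloor> + 1)) / 2 ^ Suc n"
      unfolding q_def by (intro divide_right_mono) (simp_all only: of_int_add of_int_1, simp)
    also have "\<dots> = q n" by (simp add: q_def field_simps)
    finally show ?thesis .
  qed
  then show dec: "decseq q" by (rule decseq_SucI)
  show "q n \<in> {0..1} \<inter> \<rat>" for n
  proof -
    have "q 0 \<le> 1" unfolding q_def using assms by (simp add: floor_le_iff)
    then have "q n \<le> 1" using decseqD[OF dec, of 0 n] by simp
    then show ?thesis using gt[of n] assms by (auto simp: q_def)
  qed
  show "t < q n" for n by (rule gt)
  have "(\<lambda>n. t + (1/2 :: real) ^ n) \<longlonglongrightarrow> t + 0"
    by (intro tendsto_intros LIMSEQ_power_zero) auto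
  then show "q \<longlonglongrightarrow> t"
    by (intro tendsto_sandwich[of "\<lambda>_. t" q sequentially "\<lambda>n. t + (1/2) ^ n"])
      (auto intro!: always_eventually less_imp_le[OF gt] le)
qed

text \<open>\<open>ennreal\<close> truncates negative numbers to 0, so the set also contains the
  negative half-line, which the uniform law does not charge.\<close>

lemma emeasure_uniform_le:
  assumes "y \<le> 1"
  shows "emeasure (uniform_measure lborel {0..1::real}) {u. ennreal u \<le> y} = y"
proof -
  obtain r where r: "y = ennreal r" "0 \<le> r" "r \<le> 1"
    using assms by (cases y) (auto simp: top_unique)
  have "{0..1} \<inter> {u. ennreal u \<le> y} = {0..r}"
    using r by (auto simp: ennreal_le_iff)
  moreover have "{u. ennreal u \<le> y} \<in> sets lborel" by measurable
  ultimately show ?thesis using r divide_ennreal[of r 1] by simp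
qed

text \<open>Conditional tail probabilities exist as Radon-Nikodym densities, but they are consistent
  only almost everywhere. Passing to a quantile function repairs this: every
  \<open>\<kappa> x\<close> is the law of a random variable, hence a probability measure, even where
  the versions are inconsistent. The identity is then checked on rays, which determine finite
  measures on the line.\<close>

lemma disintegration_unit_interval:
  fixes Y :: "'w \<Rightarrow> real"
  assumes P: "prob_space P"
    and [measurable]: "X \<in> P \<rightarrow>\<^sub>M N" "Y \<in> borel_measurable P"
    and Y01: "\<And>w. w \<in> space P \<Longrightarrow> 0 \<le> Y w \<and> Y w \<le> 1"
  obtains \<kappa> where "\<kappa> \<in> N \<rightarrow>\<^sub>M prob_algebra borel"
    "\<And>A B. A \<in> sets N \<Longrightarrow> B \<in> sets borel \<Longrightarrow>
      emeasure P {w\<in>space P. X w \<in> A \<and> Y w \<in> B} = (\<integral>\<^sup>+x\<in>A. emeasure (\<kappa> x) B \<partial>distr P N X)"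
proof -
  interpret P: prob_space P by fact
  define R where "R = distr P N X"
  have sR[measurable_cong, simp]: "sets R = sets N" by (simp add: R_def)
  interpret R: prob_space R unfolding R_def by (rule P.prob_space_distr) simp
  \<comment> \<open>\<open>T q\<close> is the part of the law of \<open>X\<close> that comes from
    the event \<open>q < Y\<close>. It is dominated by \<open>R\<close>, so it has a
    density.\<close>
  define T where "T q = distr (density P (indicator {w\<in>space P. q < Y w})) N X" for q
  have sT[simp]: "sets (T q) = sets N" for q by (simp add: T_def)
  have T: "emeasure (T q) A = emeasure P {w\<in>space P. X w \<in> A \<and> q < Y w}" if A[measurable]: "A \<in> sets N" for q A
  proof -
    have "emeasure (T q) A = (\<integral>\<^sup>+w. indicator {w\<in>space P. X w \<in> A \<and> q < Y w} w \<partial>P)"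
      unfolding T_def
      by (auto simp: emeasure_distr emeasure_density indicator_def intro!: nn_integral_cong)
    then show ?thesis by simp
  qed
  have R: "emeasure R A = emeasure P {w\<in>space P. X w \<in> A}" if "A \<in> sets N" for A
    unfolding R_def using that by (simp add: emeasure_distr vimage_def Int_def conj_commute)
  have TR: "emeasure (T q) A \<le> emeasure R A" if [measurable]: "A \<in> sets N" for q A
    by (auto simp: T R intro!: emeasure_mono)
  define G where "G q = RN_deriv R (T q)" for q
  have [measurable]: "G q \<in> borel_measurable R" for q unfolding G_def by measurable
  have [measurable]: "G q \<in> borel_measurable N" for q
    using measurable_cong_sets[OF sR refl] \<open>G q \<in> borel_measurable R\<close> by blast
  have G: "(\<integral>\<^sup>+x\<in>A. G q x \<partial>R) = emeasure P {w\<in>space P. X w \<in> A \<and> q < Y w}" if A: "A \<in> sets N" for q A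
  proof -
    have "absolutely_continuous R (T q)"
      using TR unfolding absolutely_continuous_def null_sets_def by (auto simp: le_zero_eq) (metis le_zero_eq)
    then have "density R (G q) = T q"
      unfolding G_def by (intro R.density_RN_deriv) auto
    then have "emeasure (density R (G q)) A = emeasure (T q) A" by simp
    then show ?thesis using A by (simp add: emeasure_density T)
  qed
  have G_fin: "(\<integral>\<^sup>+x. G q x \<partial>R) \<noteq> \<infinity>" for q
  proof -
    have "(\<integral>\<^sup>+x. G q x \<partial>R) = (\<integral>\<^sup>+x\<in>space N. G q x \<partial>R)"
      by (intro nn_integral_cong) (auto simp: R_def)
    also have "\<dots> \<noteq> \<infinity>" by (subst G) auto
    finally show ?thesis .
  qed
  have "AE x in R. G q x \<le> 1" for q
  proof (rule AE_le_of_set_nn_integral_le)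
    show "(\<integral>\<^sup>+x\<in>A. G q x \<partial>R) \<le> (\<integral>\<^sup>+x\<in>A. 1 \<partial>R)" if "A \<in> sets R" for A
      using that TR[of A q] by (simp add: G T)
  qed (auto simp: G_fin[simplified])
  then have "AE x in R. \<forall>q\<in>\<rat>. G q x \<le> 1"
    by (simp add: AE_ball_countable[OF countable_rat])
  moreover have "AE x in R. q \<le> q' \<longrightarrow> G q' x \<le> G q x" for q q'
  proof (cases "q \<le> q'")
    case True
    have "AE x in R. G q' x \<le> G q x"
    proof (rule AE_le_of_set_nn_integral_le)
      show "(\<integral>\<^sup>+x\<in>A. G q' x \<partial>R) \<le> (\<integral>\<^sup>+x\<in>A. G q x \<partial>R)" if "A \<in> sets R" for A
        using that True by (auto simp: G intro!: emeasure_mono)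
    qed (auto simp: G_fin[simplified])
    then show ?thesis by simp
  qed simp
  \<comment> \<open>Only countably many pairs of rationals occur, so the exceptional null sets can
    be united into one.\<close>
  then have "AE x in R. \<forall>q\<in>\<rat>. \<forall>q'\<in>\<rat>. q \<le> q' \<longrightarrow> G q' x \<le> G q x"
    by (simp add: AE_ball_countable[OF countable_rat])
  ultimately have AE_G: "AE x in R. (\<forall>q\<in>\<rat>. G q x \<le> 1) \<and> (\<forall>q\<in>\<rat>. \<forall>q'\<in>\<rat>. q \<le> q' \<longrightarrow> G q' x \<le> G q x)"
    by eventually_elim auto

  define I where "I = {0..1::real} \<inter> \<rat>"
  have I: "countable I" "0 \<in> I" "q \<in> I \<Longrightarrow> 0 \<le> q \<and> q \<le> 1" for q
    unfolding I_def using countable_rat by auto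
  \<comment> \<open>\<open>G q x\<close> is a version of the conditional probability of \<open>Y > q\<close> given \<open>X = x\<close>, and \<open>Q x\<close> is the
    corresponding quantile function; the kernel is the law of \<open>Q x\<close> under the uniform distribution.\<close>
  define Q where "Q x u = (SUP q\<in>I. if ennreal u \<le> G q x then q else 0)" for x and u :: real
  have bdd: "bdd_above ((\<lambda>q. if ennreal u \<le> G q x then q else 0) ` I)" for x u
    using I by (intro bdd_aboveI[of _ 1]) auto
  \<comment> \<open>The default value 0 in \<open>Q\<close> never exceeds a nonnegative
    \<open>t\<close>, so only levels \<open>q\<close> satisfying the condition count.\<close>
  have Q_gt: "t < Q x u \<longleftrightarrow> (\<exists>q\<in>I. t < q \<and> ennreal u \<le> G q x)" if "0 \<le> t" for t x u
    unfolding Q_def using that I(2) by (subst less_cSUP_iff[OF _ bdd]) (auto split: if_splits)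
  have Q_nonneg: "0 \<le> Q x u" for x u
    unfolding Q_def by (rule cSUP_upper2[OF bdd I(2)]) simp
  \<comment> \<open>The supremum runs over a countable set that does not depend on \<open>x\<close>
    or \<open>u\<close>; this is what the default value 0 is for.\<close>
  have [measurable]: "(\<lambda>(x, u). Q x u) \<in> borel_measurable (N \<Otimes>\<^sub>M borel)"
    unfolding Q_def case_prod_beta by (intro borel_measurable_cSUP I bdd) measurable
  define U where "U = uniform_measure lborel {0..1::real}"
  have [measurable_cong, simp]: "sets U = sets borel" by (simp add: U_def)
  interpret U: prob_space U unfolding U_def by (rule prob_space_uniform_measure) auto
  define \<kappa> where "\<kappa> x = distr U borel (Q x)" for x
  have U_sub: "U \<in> space (subprob_algebra borel)"
    by (simp add: space_subprob_algebra U.prob_space_axioms prob_space_imp_subprob_space)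
  have Qx[measurable]: "Q x \<in> borel_measurable U" if "x \<in> space N" for x
    using that by measurable
  have \<kappa>_sub[measurable]: "\<kappa> \<in> N \<rightarrow>\<^sub>M subprob_algebra borel"
    unfolding \<kappa>_def using U_sub by (intro measurable_distr2[where M=borel]) auto
  have \<kappa>_prob: "\<kappa> \<in> N \<rightarrow>\<^sub>M prob_algebra borel"
    using \<kappa>_sub by (intro measurable_prob_algebraI) (auto simp: \<kappa>_def intro!: U.prob_space_distr)
  have key: "(\<integral>\<^sup>+x\<in>A. emeasure (\<kappa> x) {t<..} \<partial>R) = emeasure P {w\<in>space P. X w \<in> A \<and> t < Y w}"
    if A[measurable]: "A \<in> sets N" for A t
  proof -
    have \<kappa>: "emeasure (\<kappa> x) {t<..} = emeasure U {u. t < Q x u}" if "x \<in> space N" for x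
      unfolding \<kappa>_def using that by (simp add: emeasure_distr vimage_def U_def)
    \<comment> \<open>The values of \<open>Y\<close> and of \<open>Q x\<close> lie between 0 and 1,
      so the first two cases are trivial. In the third, rationals decreasing strictly to
      \<open>t\<close> reduce the claim to the defining property of the densities.\<close>
    consider "t < 0" | "t \<ge> 1" | "0 \<le> t" "t < 1" by linarith
    then show ?thesis
    proof cases
      case 1
      have "(\<integral>\<^sup>+x\<in>A. emeasure (\<kappa> x) {t<..} \<partial>R) = (\<integral>\<^sup>+x\<in>A. 1 \<partial>R)"
      proof (intro nn_integral_cong)
        fix x assume "x \<in> space R"
        then have "x \<in> space N" by (simp add: R_def)
        moreover have "{u. t < Q x u} = space U" using 1 Q_nonneg[of x] less_le_trans by (auto simp: U_def)
        ultimately show "emeasure (\<kappa> x) {t<..} * indicator A x = 1 * indicator A x"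
          using U.emeasure_space_1 by (simp add: \<kappa>)
      qed
      also have "\<dots> = emeasure P {w\<in>space P. X w \<in> A}" using A by (simp add: R)
      also have "{w\<in>space P. X w \<in> A} = {w\<in>space P. X w \<in> A \<and> t < Y w}"
        using 1 Y01 by force
      finally show ?thesis .
    next
      case 2
      have "(\<integral>\<^sup>+x\<in>A. emeasure (\<kappa> x) {t<..} \<partial>R) = (\<integral>\<^sup>+x. 0 \<partial>R)"
      proof (intro nn_integral_cong)
        fix x assume "x \<in> space R"
        then have "x \<in> space N" by (simp add: R_def)
        moreover have "{u. t < Q x u} = {}" using 2 I(3) by (subst Q_gt) fastforce+
        ultimately show "emeasure (\<kappa> x) {t<..} * indicator A x = 0" by (simp add: \<kappa>)
      qed
      moreover have "{w\<in>space P. X w \<in> A \<and> t < Y w} = {}" using 2 Y01 by force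
      then have "emeasure P {w\<in>space P. X w \<in> A \<and> t < Y w} = emeasure P {}" by (rule arg_cong)
      ultimately show ?thesis by simp
    next
      case 3
      obtain q where q: "decseq q" "\<And>n. q n \<in> {0..1} \<inter> \<rat>" "\<And>n. t < q n" "q \<longlonglongrightarrow> t"
        using decreasing_rationals[OF 3] by blast
      have ex: "\<exists>n. q n < s" if "t < s" for s
        using order_tendstoD(2)[OF q(4) that] by (auto simp: eventually_sequentially)
      have AE_SUP: "AE x in R. emeasure (\<kappa> x) {t<..} = (SUP n. G (q n) x) \<and> (\<forall>n. G (q n) x \<le> G (q (Suc n)) x)"
        using AE_G AE_space
      proof eventually_elim
        case (elim x)
        then have x: "x \<in> space N" by (simp add: R_def)
        have inc: "G (q n) x \<le> G (q m) x" if "n \<le> m" for n m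
          using elim q(2) decseqD[OF q(1) that] by auto
        \<comment> \<open>A level \<open>s\<close> above \<open>t\<close> that witnesses
          \<open>t < Q x u\<close> can be lowered to some \<open>q n\<close>, because
          \<open>G\<close> decreases in the level.\<close>
        have "{u. t < Q x u} = (\<Union>n. {u. ennreal u \<le> G (q n) x})"
        proof (intro equalityI subsetI)
          fix u assume "u \<in> {u. t < Q x u}"
          then obtain s where s: "s \<in> I" "t < s" "ennreal u \<le> G s x" using Q_gt 3 by auto
          obtain n where "q n < s" using ex s by blast
          then have "G s x \<le> G (q n) x" using elim q(2) s(1) by (auto simp: I_def)
          then show "u \<in> (\<Union>n. {u. ennreal u \<le> G (q n) x})" using s by (auto intro: order_trans)
        next
          fix u assume "u \<in> (\<Union>n. {u. ennreal u \<le> G (q n) x})"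
          then obtain n where "ennreal u \<le> G (q n) x" by blast
          then have "t < Q x u" unfolding Q_gt[OF 3(1)] I_def using q(2)[of n] q(3)[of n] by blast
          then show "u \<in> {u. t < Q x u}" by simp
        qed
        then have "emeasure (\<kappa> x) {t<..} = emeasure U (\<Union>n. {u. ennreal u \<le> G (q n) x})"
          using \<kappa>[OF x] by simp
        also have "\<dots> = (SUP n. emeasure U {u. ennreal u \<le> G (q n) x})"
          using inc by (intro SUP_emeasure_incseq[symmetric])
            (auto simp: incseq_def intro: order_trans)
        also have "\<dots> = (SUP n. G (q n) x)"
          unfolding U_def using elim q(2) by (intro SUP_cong refl emeasure_uniform_le) auto
        finally show ?case using inc by auto
      qed
      have "(\<integral>\<^sup>+x\<in>A. emeasure (\<kappa> x) {t<..} \<partial>R) = (\<integral>\<^sup>+x. (SUP n. G (q n) x * indicator A x) \<partial>R)"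
        by (intro nn_integral_cong_AE, use AE_SUP in eventually_elim) (simp add: SUP_mult_right_ennreal)
      also have "\<dots> = (SUP n. \<integral>\<^sup>+x\<in>A. G (q n) x \<partial>R)"
      proof (rule nn_integral_monotone_convergence_SUP_AE)
        show "AE x in R. G (q n) x * indicator A x \<le> G (q (Suc n)) x * indicator A x" for n
          using AE_SUP by eventually_elim (auto simp: indicator_def)
      qed simp
      also have "\<dots> = (SUP n. emeasure P {w\<in>space P. X w \<in> A \<and> q n < Y w})"
        using A by (simp add: G)
      also have "\<dots> = emeasure P (\<Union>n. {w\<in>space P. X w \<in> A \<and> q n < Y w})"
        using decseqD[OF q(1)] by (intro SUP_emeasure_incseq) (auto simp: incseq_def intro: le_less_trans)
      also have "(\<Union>n. {w\<in>space P. X w \<in> A \<and> q n < Y w}) = {w\<in>space P. X w \<in> A \<and> t < Y w}"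
        using ex q(3) by (auto intro: less_trans)
      finally show ?thesis .
    qed
  qed
  show ?thesis
  proof (rule that[OF \<kappa>_prob])
    fix A and B :: "real set" assume A[measurable]: "A \<in> sets N" and B[measurable]: "B \<in> sets borel"
    have ne: "space R \<noteq> {}" by (rule R.not_empty)
    \<comment> \<open>For fixed \<open>A\<close> both sides of the identity are finite measures in
      \<open>B\<close>. They agree on rays by \<open>key\<close>.\<close>
    let ?M1 = "distr (density P (indicator {w\<in>space P. X w \<in> A})) borel Y"
    let ?M2 = "density R (indicator A) \<bind> \<kappa>"
    have [measurable]: "\<kappa> \<in> density R (indicator A) \<rightarrow>\<^sub>M subprob_algebra borel" by simp
    have 1: "emeasure ?M1 C = emeasure P {w\<in>space P. X w \<in> A \<and> Y w \<in> C}" if [measurable]: "C \<in> sets borel" for C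
    proof -
      have "emeasure ?M1 C = (\<integral>\<^sup>+w. indicator {w\<in>space P. X w \<in> A \<and> Y w \<in> C} w \<partial>P)"
        by (auto simp: emeasure_distr emeasure_density indicator_def intro!: nn_integral_cong)
      then show ?thesis by simp
    qed
    have 2: "emeasure ?M2 C = (\<integral>\<^sup>+x\<in>A. emeasure (\<kappa> x) C \<partial>R)" if [measurable]: "C \<in> sets borel" for C
      using ne by (subst emeasure_bind[where N=borel]) (auto simp: nn_integral_density mult.commute)
    have "?M1 = ?M2"
    proof (rule measure_eqI_lessThan)
      show "sets ?M2 = sets borel" using ne by (intro sets_bind) (auto simp: \<kappa>_def)
      show "emeasure ?M1 {x<..} < \<infinity>" for x by (subst 1) (auto simp: less_top[symmetric])
      show "emeasure ?M1 {x<..} = emeasure ?M2 {x<..}" for x by (simp add: 1 2 key)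
    qed simp
    then show "emeasure P {w\<in>space P. X w \<in> A \<and> Y w \<in> B} = (\<integral>\<^sup>+x\<in>A. emeasure (\<kappa> x) B \<partial>distr P N X)"
      using 1[OF B] 2[OF B] by (simp add: R_def)
  qed
qed

section \<open>Transfer of disintegration to path spaces\<close>

text \<open>The real variable \<open>g (Y w)\<close> is disintegrated and the resulting kernel is
  pushed forward by the decoder \<open>h\<close>. Since both joint measures are finite, it suffices
  to compare them on measurable rectangles.\<close>

lemma disintegration_encoded:
  fixes g :: "'b \<Rightarrow> real"
  assumes P: "prob_space P"
    and [measurable]: "X \<in> P \<rightarrow>\<^sub>M N" "Y \<in> P \<rightarrow>\<^sub>M M" "g \<in> borel_measurable M" "h \<in> borel \<rightarrow>\<^sub>M M"
    and gh: "\<And>y. y \<in> space M \<Longrightarrow> h (g y) = y \<and> 0 \<le> g y \<and> g y \<le> 1"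
  obtains \<kappa> where "\<kappa> \<in> N \<rightarrow>\<^sub>M prob_algebra M"
    "distr P (N \<Otimes>\<^sub>M M) (\<lambda>w. (X w, Y w)) = distr P N X \<bind> (\<lambda>x. distr (\<kappa> x) (N \<Otimes>\<^sub>M M) (Pair x))"
proof -
  interpret P: prob_space P by fact
  have Y: "Y w \<in> space M" if "w \<in> space P" for w
    using that measurable_space[OF \<open>Y \<in> P \<rightarrow>\<^sub>M M\<close>] by blast
  have gY: "(\<lambda>w. g (Y w)) \<in> borel_measurable P" by measurable
  obtain \<kappa>0 where \<kappa>0[measurable]: "\<kappa>0 \<in> N \<rightarrow>\<^sub>M prob_algebra (borel :: real measure)"
    and eq0: "\<And>A B. A \<in> sets N \<Longrightarrow> B \<in> sets borel \<Longrightarrow>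
      emeasure P {w\<in>space P. X w \<in> A \<and> g (Y w) \<in> B} = (\<integral>\<^sup>+x\<in>A. emeasure (\<kappa>0 x) B \<partial>distr P N X)"
    by (rule disintegration_unit_interval[OF P \<open>X \<in> P \<rightarrow>\<^sub>M N\<close> gY]) (use gh Y in simp, rule that)
  define \<kappa> where "\<kappa> x = distr (\<kappa>0 x) M h" for x
  have \<kappa>[measurable]: "\<kappa> \<in> N \<rightarrow>\<^sub>M prob_algebra M" unfolding \<kappa>_def by measurable
  note \<kappa>_sub[measurable] = measurable_prob_algebraD[OF \<kappa>]
  let ?K = "\<lambda>x. distr (\<kappa> x) (N \<Otimes>\<^sub>M M) (Pair x)"
  have K[measurable]: "?K \<in> N \<rightarrow>\<^sub>M subprob_algebra (N \<Otimes>\<^sub>M M)"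
    by (rule measurable_distr2[OF _ \<kappa>_sub]) simp
  have ne: "space (distr P N X) \<noteq> {}"
    by (rule prob_space.not_empty[OF P.prob_space_distr]) simp
  let ?M1 = "distr P (N \<Otimes>\<^sub>M M) (\<lambda>w. (X w, Y w))" and ?M2 = "distr P N X \<bind> ?K"
  have eqM: "?M1 = ?M2"
  proof (rule measure_eqI_generator_eq[OF Int_stable_pair_measure_generator[of N M], where A="\<lambda>_. space N \<times> space M"])
    fix R assume "R \<in> {A \<times> B | A B. A \<in> sets N \<and> B \<in> sets M}"
    then obtain A B where R: "R = A \<times> B" and [measurable]: "A \<in> sets N" "B \<in> sets M" by auto
    have "emeasure ?M2 R = (\<integral>\<^sup>+x. emeasure (?K x) R \<partial>distr P N X)"
      using ne by (subst emeasure_bind[where N="N \<Otimes>\<^sub>M M"]) (auto simp: R)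
    also have "\<dots> = (\<integral>\<^sup>+x\<in>A. emeasure (\<kappa>0 x) (h -` B) \<partial>distr P N X)"
    proof (intro nn_integral_cong)
      fix x assume "x \<in> space (distr P N X)"
      then have x: "x \<in> space N" by simp
      have s: "sets (\<kappa>0 x) = sets borel" "sets (\<kappa> x) = sets M"
        using measurable_space[OF \<kappa>0 x] measurable_space[OF \<kappa> x] by (auto simp: space_prob_algebra)
      have Pm: "Pair x \<in> \<kappa> x \<rightarrow>\<^sub>M N \<Otimes>\<^sub>M M" and hm: "h \<in> \<kappa>0 x \<rightarrow>\<^sub>M M"
        using x by (simp_all add: measurable_cong_sets[OF s(1) refl] measurable_cong_sets[OF s(2) refl])
      have "emeasure (?K x) R = emeasure (\<kappa> x) (Pair x -` R \<inter> space M)"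
        using emeasure_distr[OF Pm, of R] by (simp add: R sets_eq_imp_space_eq[OF s(2)])
      also have "Pair x -` R \<inter> space M = (if x \<in> A then B else {})"
        using sets.sets_into_space[OF \<open>B \<in> sets M\<close>] by (auto simp: R)
      finally have 1: "emeasure (?K x) R = emeasure (\<kappa> x) (if x \<in> A then B else {})" .
      have "emeasure (\<kappa> x) B = emeasure (\<kappa>0 x) (h -` B)"
        using emeasure_distr[OF hm \<open>B \<in> sets M\<close>] sets_eq_imp_space_eq[OF s(1)] by (simp add: \<kappa>_def)
      then show "emeasure (?K x) R = emeasure (\<kappa>0 x) (h -` B) * indicator A x"
        unfolding 1 by (cases "x \<in> A") simp_all
    qed
    also have "\<dots> = emeasure P {w\<in>space P. X w \<in> A \<and> g (Y w) \<in> h -` B}"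
      using measurable_sets[OF \<open>h \<in> borel \<rightarrow>\<^sub>M M\<close> \<open>B \<in> sets M\<close>] by (subst eq0) auto
    \<comment> \<open>Decoding recovers \<open>Y w\<close>, so \<open>g (Y w)\<close> lies in the
      preimage of \<open>B\<close> under \<open>h\<close> exactly when \<open>Y w\<close> lies in
      \<open>B\<close>.\<close>
    also have "{w\<in>space P. X w \<in> A \<and> g (Y w) \<in> h -` B} = (\<lambda>w. (X w, Y w)) -` R \<inter> space P"
      using Y gh by (auto simp: R)
    also have "emeasure P \<dots> = emeasure ?M1 R"
      by (simp add: emeasure_distr R)
    finally show "emeasure ?M1 R = emeasure ?M2 R" by simp
  next
    show "sets ?M2 = sigma_sets (space N \<times> space M) {A \<times> B | A B. A \<in> sets N \<and> B \<in> sets M}"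
      using ne by (subst sets_bind[where N="N \<Otimes>\<^sub>M M"]) (auto simp: sets_pair_measure)
    have "emeasure ?M1 (space N \<times> space M) \<le> 1"
      by (intro prob_space.emeasure_le_1 P.prob_space_distr) simp
    then show "emeasure ?M1 (space N \<times> space M) \<noteq> \<infinity>" by (auto simp: top_unique)
    show "{A \<times> B | A B. A \<in> sets N \<and> B \<in> sets M} \<subseteq> Pow (space N \<times> space M)"
      by (rule pair_measure_closed)
    show "sets ?M1 = sigma_sets (space N \<times> space M) {A \<times> B | A B. A \<in> sets N \<and> B \<in> sets M}"
      by (simp add: sets_pair_measure)
  qed auto
  show ?thesis using \<kappa> eqM by (rule that)
qed

text \<open>Paths over \<open>I\<close> are also points of the space of all functions on
  \<open>nat\<close>, which is Polish for the product topology. Its decoder may leave the product of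
  the \<open>X i\<close>; the base point \<open>x0\<close> serves to bring it back coordinate by
  coordinate.\<close>

lemma path_space_encoding:
  fixes X :: "nat \<Rightarrow> 'a::euclidean_space set"
  assumes X: "\<forall>i\<in>I. X i \<in> sets borel" and ne: "x0 \<in> space (path_space I X)"
  obtains g :: "(nat \<Rightarrow> 'a) \<Rightarrow> real" and h
  where "g \<in> borel_measurable (path_space I X)" "h \<in> borel \<rightarrow>\<^sub>M path_space I X"
    "\<And>y. y \<in> space (path_space I X) \<Longrightarrow> h (g y) = y \<and> 0 \<le> g y \<and> g y \<le> 1"
proof -
  obtain g :: "(nat \<Rightarrow> 'a) \<Rightarrow> real" and h0
    where [measurable]: "g \<in> borel_measurable borel" "h0 \<in> borel_measurable borel"
      and gh: "\<And>x. h0 (g x) = x" "\<And>x. 0 \<le> g x \<and> g x \<le> 1"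
    using polish_real_encoding by blast
  have coord: "(\<lambda>x. x i) \<in> borel_measurable (path_space I X)" for i
  proof (cases "i \<in> I")
    case True
    have "(\<lambda>x. x i) \<in> path_space I X \<rightarrow>\<^sub>M borel_on (X i)"
      using True by (rule measurable_component_singleton)
    then show ?thesis by (simp add: measurable_restrict_space2_iff)
  next
    \<comment> \<open>Off \<open>I\<close> every path has the constant value
      \<open>undefined\<close>, so these coordinates are measurable too.\<close>
    case False
    then show ?thesis
      by (subst measurable_cong[where g="\<lambda>_. undefined"]) (auto simp: space_PiM PiE_def extensional_def)
  qed
  then have id: "(\<lambda>x. x) \<in> path_space I X \<rightarrow>\<^sub>M borel"
    by (intro measurable_coordinatewise_then_product) simp
  define h where "h r = (\<lambda>i\<in>I. if h0 r i \<in> X i then h0 r i else x0 i)" for r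
  have x0: "x0 i \<in> X i" if "i \<in> I" for i
    using ne that by (auto simp: space_PiM space_restrict_space)
  show ?thesis
  proof (rule that)
    show "g \<in> borel_measurable (path_space I X)"
      using measurable_compose[OF id \<open>g \<in> borel_measurable borel\<close>] by simp
    show "h \<in> borel \<rightarrow>\<^sub>M path_space I X"
      unfolding h_def
    proof (intro measurable_restrict measurable_restrict_space2)
      fix i assume "i \<in> I"
      note [measurable] = X[rule_format, OF this]
        measurable_product_then_coordinatewise[OF \<open>h0 \<in> borel_measurable borel\<close>, of i]
      show "(\<lambda>r. if h0 r i \<in> X i then h0 r i else x0 i) \<in> borel_measurable borel" by measurable
    qed (use x0 in auto)
    show "h (g y) = y \<and> 0 \<le> g y \<and> g y \<le> 1" if "y \<in> space (path_space I X)" for y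
      using that by (auto simp: h_def gh space_PiM space_restrict_space PiE_def extensional_def fun_eq_iff)
  qed
qed

lemma path_disintegration:
  fixes X :: "nat \<Rightarrow> 'a::euclidean_space set"
  assumes P: "prob_space P"
    and X: "\<forall>i\<in>I. X i \<in> sets borel"
    and U: "U \<in> P \<rightarrow>\<^sub>M N" and V: "V \<in> P \<rightarrow>\<^sub>M path_space I X"
  obtains \<kappa> where "\<kappa> \<in> N \<rightarrow>\<^sub>M prob_algebra (path_space I X)"
    "distr P (N \<Otimes>\<^sub>M path_space I X) (\<lambda>w. (U w, V w)) =
      distr P N U \<bind> (\<lambda>x. distr (\<kappa> x) (N \<Otimes>\<^sub>M path_space I X) (Pair x))"
proof -
  interpret P: prob_space P by fact
  obtain w where "w \<in> space P" using P.not_empty by blast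
  then have V_w: "V w \<in> space (path_space I X)" using measurable_space[OF V] by blast
  obtain g :: "(nat \<Rightarrow> 'a) \<Rightarrow> real" and h
    where g: "g \<in> borel_measurable (path_space I X)" and h: "h \<in> borel \<rightarrow>\<^sub>M path_space I X"
      and gh: "\<And>y. y \<in> space (path_space I X) \<Longrightarrow> h (g y) = y \<and> 0 \<le> g y \<and> g y \<le> 1"
    by (rule path_space_encoding[OF X V_w], rule that)
  show ?thesis
    by (rule disintegration_encoded[OF P U V g h], rule gh, assumption, rule that)
qed

text \<open>Disintegration of the pair is inherited by every measurable reassembly \<open>F\<close>
  of its components. Later \<open>F\<close> joins a past to a future, or a past to the value at the
  gluing time.\<close>

lemma distr_disintegration:
  assumes P: "prob_space P" and U: "U \<in> P \<rightarrow>\<^sub>M N" and V: "V \<in> P \<rightarrow>\<^sub>M M"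
    and \<kappa>: "\<kappa> \<in> N \<rightarrow>\<^sub>M prob_algebra M"
    and eq: "distr P (N \<Otimes>\<^sub>M M) (\<lambda>w. (U w, V w)) = distr P N U \<bind> (\<lambda>x. distr (\<kappa> x) (N \<Otimes>\<^sub>M M) (Pair x))"
    and F: "F \<in> N \<Otimes>\<^sub>M M \<rightarrow>\<^sub>M K"
  shows "distr P K (\<lambda>w. F (U w, V w)) = distr P N U \<bind> (\<lambda>x. distr (\<kappa> x) K (\<lambda>y. F (x, y)))"
proof -
  interpret P: prob_space P by fact
  have UV: "(\<lambda>w. (U w, V w)) \<in> P \<rightarrow>\<^sub>M N \<Otimes>\<^sub>M M" using U V by measurable
  have ne: "space (distr P N U) \<noteq> {}"
    by (rule prob_space.not_empty[OF P.prob_space_distr[OF U]])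
  have Kr: "(\<lambda>x. distr (\<kappa> x) (N \<Otimes>\<^sub>M M) (Pair x)) \<in> distr P N U \<rightarrow>\<^sub>M subprob_algebra (N \<Otimes>\<^sub>M M)"
    using measurable_distr2[OF _ measurable_prob_algebraD[OF \<kappa>], of Pair] by simp
  have "distr P K (\<lambda>w. F (U w, V w)) = distr (distr P (N \<Otimes>\<^sub>M M) (\<lambda>w. (U w, V w))) K F"
    by (simp add: distr_distr[OF F UV] comp_def)
  also have "\<dots> = distr P N U \<bind> (\<lambda>x. distr (distr (\<kappa> x) (N \<Otimes>\<^sub>M M) (Pair x)) K F)"
    unfolding eq by (rule distr_bind[OF Kr ne F])
  also have "\<dots> = distr P N U \<bind> (\<lambda>x. distr (\<kappa> x) K (\<lambda>y. F (x, y)))"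
  proof (rule bind_cong[OF refl])
    fix x assume "x \<in> space (distr P N U)"
    then have x: "x \<in> space N" by simp
    have s: "sets (\<kappa> x) = sets M"
      using measurable_space[OF \<kappa> x] by (auto simp: space_prob_algebra)
    have "Pair x \<in> \<kappa> x \<rightarrow>\<^sub>M N \<Otimes>\<^sub>M M"
      using x by (simp add: measurable_cong_sets[OF s refl])
    then show "distr (distr (\<kappa> x) (N \<Otimes>\<^sub>M M) (Pair x)) K F = distr (\<kappa> x) K (\<lambda>y. F (x, y))"
      by (simp add: distr_distr[OF F] comp_def)
  qed
  finally show ?thesis .
qed

section \<open>Integration against composed kernels\<close>

text \<open>The identity for nonnegative integrals carries over to bounded real functions by adding
  a constant \<open>C\<close>, which contributes \<open>C\<close> on both sides because all measures
  involved are probability measures. Vector-valued functions are treated one basis coordinate at a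
  time.\<close>

lemma integral_bind_bounded:
  fixes f :: "'b \<Rightarrow> 'c::euclidean_space"
  assumes \<nu>: "\<nu> \<in> space (prob_algebra N)" and \<kappa>: "\<kappa> \<in> N \<rightarrow>\<^sub>M prob_algebra K"
    and f[measurable]: "f \<in> borel_measurable K" and B: "\<And>y. y \<in> space K \<Longrightarrow> norm (f y) \<le> B"
  shows "(LINT y|(\<nu> \<bind> \<kappa>). f y) = (LINT x|\<nu>. LINT y|\<kappa> x. f y)"
proof -
  have \<nu>': "prob_space \<nu>" and s[measurable_cong]: "sets \<nu> = sets N" using \<nu> by (auto simp: space_prob_algebra)
  interpret \<nu>: prob_space \<nu> by fact
  note \<kappa>_sub[measurable] = measurable_prob_algebraD[OF \<kappa>]
  have kp: "prob_space (\<kappa> x)" and ks: "sets (\<kappa> x) = sets K" if "x \<in> space \<nu>" for x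
    using measurable_space[OF \<kappa>, of x] that sets_eq_imp_space_eq[OF s] by (auto simp: space_prob_algebra)
  have pb: "prob_space (\<nu> \<bind> \<kappa>)" by (rule prob_space_bind'[OF \<nu> \<kappa>])
  have sb[measurable_cong]: "sets (\<nu> \<bind> \<kappa>) = sets K" by (rule sets_bind'[OF \<nu> \<kappa>])
  \<comment> \<open>\<open>Q\<close> is arbitrary here because the bounds serve both for the
    composed measure and for each \<open>\<kappa> x\<close>.\<close>
  have int: "integrable Q f'" and bd: "norm (LINT y|Q. f' y) \<le> C"
    if "prob_space Q" "sets Q = sets K" "f' \<in> borel_measurable K" "\<And>y. y \<in> space K \<Longrightarrow> norm (f' y) \<le> C"
    for Q C and f' :: "'b \<Rightarrow> 'd::{banach, second_countable_topology}"
  proof -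
    interpret Q: prob_space Q by fact
    have AE: "AE y in Q. norm (f' y) \<le> C"
      using that sets_eq_imp_space_eq[OF that(2)] by (intro AE_I2) auto
    show "integrable Q f'"
      using that AE by (intro Q.integrable_const_bound) (auto cong: measurable_cong_sets)
    then have "norm (LINT y|Q. f' y) \<le> (LINT y|Q. C)"
      using AE by (intro order_trans[OF integral_norm_bound] integral_mono_AE) auto
    then show "norm (LINT y|Q. f' y) \<le> C" by (simp add: Q.prob_space)
  qed
  have real: "(LINT y|(\<nu> \<bind> \<kappa>). r y) = (LINT x|\<nu>. LINT y|\<kappa> x. r y)"
    if r[measurable]: "r \<in> borel_measurable K" and C: "\<And>y. y \<in> space K \<Longrightarrow> \<bar>r y\<bar> \<le> C" for r :: "'b \<Rightarrow> real" and C
  proof -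
    have C': "norm (r y) \<le> C" if "y \<in> space K" for y using C that by simp
    have C'': "0 \<le> r y + C" if "y \<in> space K" for y using C[OF that] by linarith
    have plus: "ennreal ((LINT y|Q. r y) + C) = (\<integral>\<^sup>+y. ennreal (r y + C) \<partial>Q)"
      if Q: "prob_space Q" "sets Q = sets K" for Q
    proof -
      interpret Q: prob_space Q by fact
      note i = int[OF Q r C']
      have "(\<integral>\<^sup>+y. ennreal (r y + C) \<partial>Q) = ennreal (LINT y|Q. r y + C)"
        using i sets_eq_imp_space_eq[OF Q(2)] C'' by (intro nn_integral_eq_integral AE_I2) auto
      then show ?thesis using i by (simp add: Q.prob_space)
    qed
    have bq: "0 \<le> (LINT y|Q. r y) + C" if Q: "prob_space Q" "sets Q = sets K" for Q
      using bd[OF Q r C'] by (simp add: abs_le_iff)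
    have m[measurable]: "(\<lambda>x. LINT y|\<kappa> x. r y) \<in> borel_measurable N"
      by (rule measurable_compose[OF \<kappa>_sub integral_measurable_subprob_algebra[OF r]])
    have i: "integrable \<nu> (\<lambda>x. LINT y|\<kappa> x. r y)"
      using bd[OF kp ks r C'] by (intro \<nu>.integrable_const_bound[where B=C]) auto
    have "ennreal ((LINT y|(\<nu> \<bind> \<kappa>). r y) + C) = (\<integral>\<^sup>+x. \<integral>\<^sup>+y. ennreal (r y + C) \<partial>\<kappa> x \<partial>\<nu>)"
      unfolding plus[OF pb sb] by (rule nn_integral_bind) measurable
    also have "\<dots> = (\<integral>\<^sup>+x. ennreal ((LINT y|\<kappa> x. r y) + C) \<partial>\<nu>)"
      by (intro nn_integral_cong plus[symmetric] kp ks)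
    also have "\<dots> = ennreal (LINT x|\<nu>. (LINT y|\<kappa> x. r y) + C)"
      using i bq[OF kp ks] by (intro nn_integral_eq_integral AE_I2) auto
    also have "(LINT x|\<nu>. (LINT y|\<kappa> x. r y) + C) = (LINT x|\<nu>. LINT y|\<kappa> x. r y) + C"
      using i by (simp add: \<nu>.prob_space)
    finally have eq: "ennreal ((LINT y|(\<nu> \<bind> \<kappa>). r y) + C) = ennreal ((LINT x|\<nu>. LINT y|\<kappa> x. r y) + C)" .
    have "0 \<le> (LINT x|\<nu>. (LINT y|\<kappa> x. r y) + C)"
      by (intro integral_nonneg_AE AE_I2 bq kp ks)
    then have "0 \<le> (LINT x|\<nu>. LINT y|\<kappa> x. r y) + C" using i by (simp add: \<nu>.prob_space)
    with eq bq[OF pb sb] show ?thesis by (metis add_right_cancel ennreal_inj)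
  qed
  show ?thesis
  proof (rule euclidean_eqI)
    fix b :: 'c assume b: "b \<in> Basis"
    have m[measurable]: "(\<lambda>x. LINT y|\<kappa> x. f y) \<in> borel_measurable N"
      by (rule measurable_compose[OF \<kappa>_sub integral_measurable_subprob_algebra[OF f]])
    have i: "integrable \<nu> (\<lambda>x. LINT y|\<kappa> x. f y)"
      using bd[OF kp ks f B] by (intro \<nu>.integrable_const_bound[where B=B]) auto
    have "(LINT y|(\<nu> \<bind> \<kappa>). f y) \<bullet> b = (LINT y|(\<nu> \<bind> \<kappa>). f y \<bullet> b)"
      using int[OF pb sb f B] by simp
    also have "\<dots> = (LINT x|\<nu>. LINT y|\<kappa> x. f y \<bullet> b)"
      by (rule real[of "\<lambda>y. f y \<bullet> b" B]) (auto intro: order_trans[OF Basis_le_norm[OF b] B])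
    also have "\<dots> = (LINT x|\<nu>. (LINT y|\<kappa> x. f y) \<bullet> b)"
      using int[OF kp ks f B] by (intro Bochner_Integration.integral_cong) auto
    also have "\<dots> = (LINT x|\<nu>. LINT y|\<kappa> x. f y) \<bullet> b" using i by simp
    finally show "(LINT y|(\<nu> \<bind> \<kappa>). f y) \<bullet> b = (LINT x|\<nu>. LINT y|\<kappa> x. f y) \<bullet> b" .
  qed
qed

lemma integral_bind_distr:
  fixes f :: "'c \<Rightarrow> 'd::euclidean_space"
  assumes \<nu>: "\<nu> \<in> space (prob_algebra N)" and \<kappa>: "\<kappa> \<in> N \<rightarrow>\<^sub>M prob_algebra M"
    and F[measurable]: "F \<in> N \<Otimes>\<^sub>M M \<rightarrow>\<^sub>M K"
    and f[measurable]: "f \<in> borel_measurable K" and B: "\<And>z. z \<in> space K \<Longrightarrow> norm (f z) \<le> B"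
  shows "(LINT z|(\<nu> \<bind> (\<lambda>x. distr (\<kappa> x) K (\<lambda>y. F (x, y)))). f z) = (LINT x|\<nu>. LINT y|\<kappa> x. f (F (x, y)))"
proof -
  have K: "(\<lambda>x. distr (\<kappa> x) K (\<lambda>y. F (x, y))) \<in> N \<rightarrow>\<^sub>M prob_algebra K"
    by (rule measurable_distr_prob_space2[OF \<kappa>]) simp
  have "(LINT z|distr (\<kappa> x) K (\<lambda>y. F (x, y)). f z) = (LINT y|\<kappa> x. f (F (x, y)))" if "x \<in> space \<nu>" for x
  proof (rule integral_distr[OF _ f])
    have x: "x \<in> space N" using that \<nu> by (auto simp: space_prob_algebra dest: sets_eq_imp_space_eq)
    then have s: "sets (\<kappa> x) = sets M" using measurable_space[OF \<kappa>] by (auto simp: space_prob_algebra)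
    show "(\<lambda>y. F (x, y)) \<in> \<kappa> x \<rightarrow>\<^sub>M K" using x by (simp add: measurable_cong_sets[OF s refl])
  qed
  then have "(LINT x|\<nu>. LINT z|distr (\<kappa> x) K (\<lambda>y. F (x, y)). f z) = (LINT x|\<nu>. LINT y|\<kappa> x. f (F (x, y)))"
    by (intro Bochner_Integration.integral_cong refl)
  moreover have "(LINT z|(\<nu> \<bind> (\<lambda>x. distr (\<kappa> x) K (\<lambda>y. F (x, y)))). f z)
      = (LINT x|\<nu>. LINT z|distr (\<kappa> x) K (\<lambda>y. F (x, y)). f z)"
    by (rule integral_bind_bounded[OF \<nu> K f]) (rule B)
  ultimately show ?thesis by simp
qed

section \<open>Martingale couplings\<close>

lemma measurable_path_coord:
  "i \<in> I \<Longrightarrow> (\<lambda>x. x i) \<in> path_space I X \<rightarrow>\<^sub>M borel_on (X i)"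
  by (rule measurable_component_singleton)

lemma borel_measurable_path_coord:
  assumes "i \<in> I"
  shows "(\<lambda>x. x i) \<in> borel_measurable (path_space I X)"
  using measurable_path_coord[OF assms, of X] by (simp add: measurable_restrict_space2_iff)

lemma measurable_path_restrict:
  "J \<subseteq> I \<Longrightarrow> (\<lambda>x. restrict x J) \<in> path_space I X \<rightarrow>\<^sub>M path_space J X"
  by (rule measurable_restrict_subset)

lemma measurable_path_merge:
  assumes "I \<union> J = K"
  shows "merge I J \<in> path_space I X \<Otimes>\<^sub>M path_space J X \<rightarrow>\<^sub>M path_space K X"
  using measurable_merge[of I J "\<lambda>i. borel_on (X i)"] assms by simp

lemma space_path_coord: "x \<in> space (path_space I X) \<Longrightarrow> i \<in> I \<Longrightarrow> x i \<in> X i"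
  by (auto simp: space_PiM space_restrict_space)

lemma restrict_path: "x \<in> space (path_space I X) \<Longrightarrow> restrict x I = x"
  by (simp add: space_PiM PiE_def extensional_restrict)

lemma Proj_space:
  assumes "\<pi> \<in> space (prob_algebra (path_space I X))" "J \<subseteq> I"
  shows "Proj J X \<pi> \<in> space (prob_algebra (path_space J X))"
proof -
  have s: "sets \<pi> = sets (path_space I X)" and p: "prob_space \<pi>"
    using assms by (auto simp: space_prob_algebra)
  have "(\<lambda>x. restrict x J) \<in> \<pi> \<rightarrow>\<^sub>M path_space J X"
    using measurable_path_restrict[OF assms(2)] measurable_cong_sets[OF s refl] by blast
  then show ?thesis
    unfolding Proj_def by (simp add: space_prob_algebra prob_space.prob_space_distr[OF p])
qed

lemma distr_Proj:
  assumes \<pi>: "\<pi> \<in> space (prob_algebra (path_space I X))" and J: "J \<subseteq> I"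
    and f: "f \<in> path_space J X \<rightarrow>\<^sub>M M"
  shows "distr (Proj J X \<pi>) M f = distr \<pi> M (\<lambda>x. f (restrict x J))"
proof -
  have s: "sets \<pi> = sets (path_space I X)" using \<pi> by (auto simp: space_prob_algebra)
  have "(\<lambda>x. restrict x J) \<in> \<pi> \<rightarrow>\<^sub>M path_space J X"
    using measurable_path_restrict[OF J] measurable_cong_sets[OF s refl] by blast
  then show ?thesis unfolding Proj_def by (simp add: distr_distr[OF f] comp_def)
qed

lemma integral_Proj:
  fixes f :: "_ \<Rightarrow> 'b::{banach, second_countable_topology}"
  assumes \<pi>: "\<pi> \<in> space (prob_algebra (path_space I X))" and J: "J \<subseteq> I"
    and f: "f \<in> borel_measurable (path_space J X)"
  shows "(LINT x|Proj J X \<pi>. f x) = (LINT x|\<pi>. f (restrict x J))"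
proof -
  have s: "sets \<pi> = sets (path_space I X)" using \<pi> by (auto simp: space_prob_algebra)
  have "(\<lambda>x. restrict x J) \<in> \<pi> \<rightarrow>\<^sub>M path_space J X"
    using measurable_path_restrict[OF J] measurable_cong_sets[OF s refl] by blast
  then show ?thesis unfolding Proj_def by (rule integral_distr[OF _ f])
qed

lemma Proj_Proj:
  assumes "\<pi> \<in> space (prob_algebra (path_space I X))" and "J \<subseteq> I" and "J' \<subseteq> J"
  shows "Proj J' X (Proj J X \<pi>) = Proj J' X \<pi>"
  using distr_Proj[OF assms(1,2) measurable_path_restrict[OF assms(3)]] assms(3)
  by (simp add: Proj_def Int_absorb1)

lemma coupling_space: "\<pi> \<in> couplings m n X \<mu> \<Longrightarrow> \<pi> \<in> space (prob_algebra (path_space {m..n} X))"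
  by (simp add: couplings_def)

lemma martingale_coupling_space:
  "\<pi> \<in> martingale_couplings m n X \<mu> \<Longrightarrow> \<pi> \<in> space (prob_algebra (path_space {m..n} X))"
  by (auto simp: martingale_couplings_def couplings_def)

lemma martingale_coupling_marginal:
  "\<pi> \<in> martingale_couplings m n X \<mu> \<Longrightarrow> i \<in> {m..n} \<Longrightarrow> distr \<pi> (borel_on (X i)) (\<lambda>x. x i) = \<mu> i"
  by (simp add: martingale_couplings_def couplings_def)

section \<open>The martingale property in terms of test functions\<close>

text \<open>After merging, the coordinates up to \<open>i\<close> come from \<open>x\<close> and
  coordinate \<open>Suc i\<close> comes from \<open>y\<close>. The weight and \<open>x i\<close> are
  therefore constants for the inner integral, which leaves only the barycentre of the kernel.
  Compactness supplies the bounds for integrability.\<close>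

lemma integral_increment_semidirect:
  fixes X :: "nat \<Rightarrow> 'a::euclidean_space set"
  assumes X: "\<forall>j\<in>{m..n}. compact (X j)" and i: "i \<in> {m..<n}"
    and \<nu>: "\<nu> \<in> space (prob_algebra (path_space {m..i} X))"
    and \<kappa>: "\<kappa> \<in> path_space {m..i} X \<rightarrow>\<^sub>M prob_algebra (path_space {Suc i..n} X)"
    and w: "w \<in> borel_measurable (path_space {m..i} X)" "\<And>x. \<bar>w x\<bar> \<le> C"
  shows "(LINT x|semidirect m i n X \<nu> \<kappa>. w (restrict x {m..i}) *\<^sub>R (x (Suc i) - x i))
      = (LINT x|\<nu>. w x *\<^sub>R ((LINT y|\<kappa> x. y (Suc i)) - x i))"
    and "integrable \<nu> (\<lambda>x. (LINT y|\<kappa> x. y (Suc i)) - x i)"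
proof -
  have un: "{m..i} \<union> {Suc i..n} = {m..n}" using i by auto
  have ii: "i \<in> {m..i}" "Suc i \<in> {Suc i..n}" "{m..i} \<subseteq> {m..n}" "i \<in> {m..n}" "Suc i \<in> {m..n}" using i by auto
  obtain B1 B2 where B1: "\<And>x. x \<in> X (Suc i) \<Longrightarrow> norm x \<le> B1" and B2: "\<And>x. x \<in> X i \<Longrightarrow> norm x \<le> B2"
    using compact_imp_bounded[OF X[rule_format, OF ii(5)]] compact_imp_bounded[OF X[rule_format, OF ii(4)]]
    unfolding bounded_iff by blast
  note [measurable] = w(1) borel_measurable_path_coord[OF ii(1)] borel_measurable_path_coord[OF ii(2)]
    borel_measurable_path_coord[OF ii(4)] borel_measurable_path_coord[OF ii(5)] measurable_path_restrict[OF ii(3)]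
  have f: "(\<lambda>x. w (restrict x {m..i}) *\<^sub>R (x (Suc i) - x i)) \<in> borel_measurable (path_space {m..n} X)" by measurable
  have fb: "norm (w (restrict x {m..i}) *\<^sub>R (x (Suc i) - x i)) \<le> C * (B1 + B2)"
    if "x \<in> space (path_space {m..n} X)" for x
  proof -
    have "norm (x (Suc i) - x i) \<le> B1 + B2"
      using B1[OF space_path_coord[OF that ii(5)]] B2[OF space_path_coord[OF that ii(4)]]
        norm_triangle_ineq4[of "x (Suc i)" "x i"] by linarith
    moreover have "0 \<le> C" using w(2)[of x] by linarith
    ultimately show ?thesis using w(2)[of "restrict x {m..i}"] by (auto intro!: mult_mono)
  qed
  have s\<nu>: "sets \<nu> = sets (path_space {m..i} X)" "space \<nu> = space (path_space {m..i} X)" and p\<nu>: "prob_space \<nu>"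
    using \<nu> by (auto simp: space_prob_algebra dest: sets_eq_imp_space_eq)
  interpret \<nu>: prob_space \<nu> by fact
  have \<kappa>x: "prob_space (\<kappa> x)" "sets (\<kappa> x) = sets (path_space {Suc i..n} X)"
    "space (\<kappa> x) = space (path_space {Suc i..n} X)"
    if "x \<in> space \<nu>" for x
    using measurable_space[OF \<kappa>, of x] that s\<nu>(2) by (auto simp: space_prob_algebra dest: sets_eq_imp_space_eq)
  have int: "integrable (\<kappa> x) (\<lambda>y. y (Suc i))" and bd: "norm (LINT y|\<kappa> x. y (Suc i)) \<le> B1"
    if x: "x \<in> space \<nu>" for x
  proof -
    interpret k: prob_space "\<kappa> x" by (rule \<kappa>x[OF x])
    have AE: "AE y in \<kappa> x. norm (y (Suc i)) \<le> B1"
      using B1[OF space_path_coord[of _ "{Suc i..n}" X "Suc i", OF _ ii(2)]] by (intro AE_I2) (simp add: \<kappa>x(3)[OF x])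
    have "(\<lambda>y. y (Suc i)) \<in> borel_measurable (\<kappa> x)"
      using borel_measurable_path_coord[OF ii(2)] measurable_cong_sets[OF \<kappa>x(2)[OF x] refl] by blast
    with AE show "integrable (\<kappa> x) (\<lambda>y. y (Suc i))"
      by (intro k.integrable_const_bound)
    then have "norm (LINT y|\<kappa> x. y (Suc i)) \<le> (LINT y|\<kappa> x. B1)"
      using AE by (intro order_trans[OF integral_norm_bound] integral_mono_AE) auto
    then show "norm (LINT y|\<kappa> x. y (Suc i)) \<le> B1" by (simp add: k.prob_space)
  qed
  have "(LINT x|semidirect m i n X \<nu> \<kappa>. w (restrict x {m..i}) *\<^sub>R (x (Suc i) - x i))
      = (LINT x|\<nu>. LINT y|\<kappa> x. (\<lambda>z. w (restrict z {m..i}) *\<^sub>R (z (Suc i) - z i)) (merge {m..i} {Suc i..n} (x, y)))"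
    unfolding semidirect_def
    by (rule integral_bind_distr[OF \<nu> \<kappa> measurable_path_merge[OF un] f fb])
  also have "\<dots> = (LINT x|\<nu>. w x *\<^sub>R ((LINT y|\<kappa> x. y (Suc i)) - x i))"
  proof (intro Bochner_Integration.integral_cong refl)
    fix x assume x: "x \<in> space \<nu>"
    interpret k: prob_space "\<kappa> x" by (rule \<kappa>x[OF x])
    have "restrict x {m..i} = x" using x s\<nu>(2) restrict_path by blast
    then show "(LINT y|\<kappa> x. w (restrict (merge {m..i} {Suc i..n} (x, y)) {m..i}) *\<^sub>R
        (merge {m..i} {Suc i..n} (x, y) (Suc i) - merge {m..i} {Suc i..n} (x, y) i))
      = w x *\<^sub>R ((LINT y|\<kappa> x. y (Suc i)) - x i)"
      using ii int[OF x] by (simp add: k.prob_space)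
  qed
  finally show "(LINT x|semidirect m i n X \<nu> \<kappa>. w (restrict x {m..i}) *\<^sub>R (x (Suc i) - x i))
      = (LINT x|\<nu>. w x *\<^sub>R ((LINT y|\<kappa> x. y (Suc i)) - x i))" .
  have m: "(\<lambda>x. LINT y|\<kappa> x. y (Suc i)) \<in> borel_measurable (path_space {m..i} X)"
    by (rule measurable_compose[OF measurable_prob_algebraD[OF \<kappa>] integral_measurable_subprob_algebra]) measurable
  show "integrable \<nu> (\<lambda>x. (LINT y|\<kappa> x. y (Suc i)) - x i)"
  proof (rule \<nu>.integrable_const_bound)
    show "AE x in \<nu>. norm ((LINT y|\<kappa> x. y (Suc i)) - x i) \<le> B1 + B2"
    proof (rule AE_I2)
      fix x assume x: "x \<in> space \<nu>"
      have "norm (x i) \<le> B2" using B2[OF space_path_coord[of _ "{m..i}" X i, OF _ ii(1)]] x s\<nu>(2) by simp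
      then show "norm ((LINT y|\<kappa> x. y (Suc i)) - x i) \<le> B1 + B2"
        using bd[OF x] norm_triangle_ineq4[of "LINT y|\<kappa> x. y (Suc i)" "x i"] by linarith
    qed
    show "(\<lambda>x. (LINT y|\<kappa> x. y (Suc i)) - x i) \<in> borel_measurable \<nu>"
      using m by (simp add: measurable_cong_sets[OF s\<nu>(1) refl])
  qed
qed

text \<open>With a kernel witnessing the martingale property, the integrand left after integrating
  out the future vanishes almost everywhere.\<close>

lemma martingale_couplingD:
  fixes X :: "nat \<Rightarrow> 'a::euclidean_space set"
  assumes X: "\<forall>j\<in>{m..n}. compact (X j)" and \<pi>: "\<pi> \<in> martingale_couplings m n X \<mu>" and i: "i \<in> {m..<n}"
    and w: "w \<in> borel_measurable (path_space {m..i} X)" "\<And>x. \<bar>w x\<bar> \<le> C"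
  shows "(LINT x|\<pi>. w (restrict x {m..i}) *\<^sub>R (x (Suc i) - x i)) = 0"
proof -
  let ?\<nu> = "Proj {m..i} X \<pi>"
  obtain \<kappa> where \<kappa>: "\<kappa> \<in> path_space {m..i} X \<rightarrow>\<^sub>M prob_algebra (path_space {Suc i..n} X)"
    and eq: "\<pi> = semidirect m i n X ?\<nu> \<kappa>"
    and bary: "AE x in ?\<nu>. (LINT y|\<kappa> x. y (Suc i)) = x i"
    using \<pi> i unfolding martingale_couplings_def by blast
  have \<nu>: "?\<nu> \<in> space (prob_algebra (path_space {m..i} X))"
    using i by (intro Proj_space[OF martingale_coupling_space[OF \<pi>]]) auto
  have "(LINT x|\<pi>. w (restrict x {m..i}) *\<^sub>R (x (Suc i) - x i))
      = (LINT x|?\<nu>. w x *\<^sub>R ((LINT y|\<kappa> x. y (Suc i)) - x i))"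
    by (subst eq) (rule integral_increment_semidirect(1)[OF X i \<nu> \<kappa> w])
  also have "\<dots> = 0"
    by (rule integral_eq_zero_AE) (use bary in \<open>eventually_elim, simp\<close>)
  finally show ?thesis .
qed

text \<open>A path is cut after time \<open>i\<close> into past and future. The future is
  disintegrated given the past, and \<open>merge\<close> restores the path.\<close>

lemma semidirect_disintegration:
  fixes X :: "nat \<Rightarrow> 'a::euclidean_space set"
  assumes X: "\<forall>j\<in>{m..n}. compact (X j)" and i: "i \<in> {m..<n}"
    and \<pi>: "\<pi> \<in> space (prob_algebra (path_space {m..n} X))"
  obtains \<kappa> where "\<kappa> \<in> path_space {m..i} X \<rightarrow>\<^sub>M prob_algebra (path_space {Suc i..n} X)"
    "\<pi> = semidirect m i n X (Proj {m..i} X \<pi>) \<kappa>"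
proof -
  have p: "prob_space \<pi>" and s: "sets \<pi> = sets (path_space {m..n} X)" using \<pi> by (auto simp: space_prob_algebra)
  have un: "{m..i} \<union> {Suc i..n} = {m..n}" using i by auto
  have sub: "{m..i} \<subseteq> {m..n}" "{Suc i..n} \<subseteq> {m..n}" using i by auto
  have borel: "\<forall>j\<in>{Suc i..n}. X j \<in> sets borel" using X i by (auto intro!: borel_compact)
  have U: "(\<lambda>x. restrict x {m..i}) \<in> \<pi> \<rightarrow>\<^sub>M path_space {m..i} X"
    and V: "(\<lambda>x. restrict x {Suc i..n}) \<in> \<pi> \<rightarrow>\<^sub>M path_space {Suc i..n} X"
    using measurable_path_restrict[OF sub(1)] measurable_path_restrict[OF sub(2)]
      measurable_cong_sets[OF s refl] by blast+
  obtain \<kappa> where \<kappa>: "\<kappa> \<in> path_space {m..i} X \<rightarrow>\<^sub>M prob_algebra (path_space {Suc i..n} X)"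
    and dis: "distr \<pi> (path_space {m..i} X \<Otimes>\<^sub>M path_space {Suc i..n} X) (\<lambda>x. (restrict x {m..i}, restrict x {Suc i..n}))
      = distr \<pi> (path_space {m..i} X) (\<lambda>x. restrict x {m..i}) \<bind>
        (\<lambda>x. distr (\<kappa> x) (path_space {m..i} X \<Otimes>\<^sub>M path_space {Suc i..n} X) (Pair x))"
    by (rule path_disintegration[OF p borel U V], rule that)
  have "\<pi> = distr \<pi> (path_space {m..n} X) (\<lambda>x. x)"
    using s by (simp add: distr_id2)
  also have "\<dots> = distr \<pi> (path_space {m..n} X) (\<lambda>x. merge {m..i} {Suc i..n} (restrict x {m..i}, restrict x {Suc i..n}))"
    using sets_eq_imp_space_eq[OF s] by (intro distr_cong) (auto simp: un restrict_path)
  also have "\<dots> = semidirect m i n X (Proj {m..i} X \<pi>) \<kappa>"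
    unfolding semidirect_def Proj_def
    by (rule distr_disintegration[OF p U V \<kappa> dis measurable_path_merge[OF un]])
  finally have eq: "\<pi> = semidirect m i n X (Proj {m..i} X \<pi>) \<kappa>" .
  from \<kappa> eq show ?thesis by (rule that)
qed

text \<open>Take any disintegration kernel. The hypothesis says that the defect between its
  barycentre and \<open>x i\<close> integrates to zero over every measurable set of pasts, so it
  vanishes almost everywhere. Indicators thus suffice as test functions.\<close>

lemma martingale_couplingI:
  fixes X :: "nat \<Rightarrow> 'a::euclidean_space set"
  assumes X: "\<forall>j\<in>{m..n}. compact (X j)" and \<pi>: "\<pi> \<in> couplings m n X \<mu>"
    and zero: "\<And>i A. i \<in> {m..<n} \<Longrightarrow> A \<in> sets (path_space {m..i} X) \<Longrightarrow>
      (LINT x|\<pi>. (indicator A (restrict x {m..i}) :: real) *\<^sub>R (x (Suc i) - x i)) = 0"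
  shows "\<pi> \<in> martingale_couplings m n X \<mu>"
  unfolding martingale_couplings_def
proof (intro CollectI conjI \<pi> ballI)
  fix i assume i: "i \<in> {m..<n}"
  let ?\<nu> = "Proj {m..i} X \<pi>"
  have \<pi>': "\<pi> \<in> space (prob_algebra (path_space {m..n} X))" by (rule coupling_space[OF \<pi>])
  have \<nu>: "?\<nu> \<in> space (prob_algebra (path_space {m..i} X))" using i by (intro Proj_space[OF \<pi>']) auto
  obtain \<kappa> where \<kappa>: "\<kappa> \<in> path_space {m..i} X \<rightarrow>\<^sub>M prob_algebra (path_space {Suc i..n} X)"
    and eq: "\<pi> = semidirect m i n X ?\<nu> \<kappa>"
    by (rule semidirect_disintegration[OF X i \<pi>'], rule that)
  have "AE x in ?\<nu>. (LINT y|\<kappa> x. y (Suc i)) - x i = 0"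
  proof (rule sigma_finite_measure.density_zero)
    show "sigma_finite_measure ?\<nu>"
      using \<nu> by (auto simp: space_prob_algebra prob_space_imp_sigma_finite)
    show "integrable ?\<nu> (\<lambda>x. (LINT y|\<kappa> x. y (Suc i)) - x i)"
      by (rule integral_increment_semidirect(2)[OF X i \<nu> \<kappa>, of "\<lambda>_. 0" 0]) auto
    fix A assume "A \<in> sets ?\<nu>"
    then have A: "A \<in> sets (path_space {m..i} X)" using \<nu> by (auto simp: space_prob_algebra)
    have "(LINT x:A|?\<nu>. (LINT y|\<kappa> x. y (Suc i)) - x i)
        = (LINT x|semidirect m i n X ?\<nu> \<kappa>. (indicator A (restrict x {m..i}) :: real) *\<^sub>R (x (Suc i) - x i))"
      unfolding set_lebesgue_integral_def using A
      by (intro integral_increment_semidirect(1)[OF X i \<nu> \<kappa>, symmetric, where C=1]) (auto simp: indicator_def)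
    also have "\<dots> = 0" using zero[OF i A] eq by simp
    finally show "(LINT x:A|?\<nu>. (LINT y|\<kappa> x. y (Suc i)) - x i) = 0" .
  qed
  then have "AE x in ?\<nu>. (LINT y|\<kappa> x. y (Suc i)) = x i" by eventually_elim simp
  with \<kappa> eq show "\<exists>\<kappa>\<in>path_space {m..i} X \<rightarrow>\<^sub>M prob_algebra (path_space {Suc i..n} X).
      \<pi> = semidirect m i n X ?\<nu> \<kappa> \<and> (AE x in ?\<nu>. (LINT y|\<kappa> x. y (Suc i)) = x i)"
    by blast
qed

section \<open>Additive costs\<close>

text \<open>Continuity is given only on the product of the two compact sets, so measurability goes
  through the restricted Borel space; the bound comes from the compact image.\<close>

lemma pair_cost_measurable_bounded:
  fixes X :: "nat \<Rightarrow> 'a::euclidean_space set" and c :: "'a \<times> 'a \<Rightarrow> real"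
  assumes ij: "i \<in> I" "j \<in> I" and X: "compact (X i)" "compact (X j)"
    and c: "continuous_on (X i \<times> X j) c"
  shows "(\<lambda>x. c (x i, x j)) \<in> borel_measurable (path_space I X)"
    and "\<exists>B. \<forall>x\<in>space (path_space I X). norm (c (x i, x j)) \<le> B"
proof -
  have in_prod: "(x i, x j) \<in> X i \<times> X j" if "x \<in> space (path_space I X)" for x
    using space_path_coord[OF that ij(1)] space_path_coord[OF that ij(2)] by simp
  have "(\<lambda>x. (x i, x j)) \<in> path_space I X \<rightarrow>\<^sub>M borel_on (X i \<times> X j)"
  proof (rule measurable_restrict_space2)
    show "(\<lambda>x. (x i, x j)) \<in> borel_measurable (path_space I X)"
      using borel_measurable_path_coord[OF ij(1), of X] borel_measurable_path_coord[OF ij(2), of X]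
      by (rule borel_measurable_Pair)
  qed (use in_prod in auto)
  from measurable_compose[OF this borel_measurable_continuous_on_restrict[OF c]]
  show "(\<lambda>x. c (x i, x j)) \<in> borel_measurable (path_space I X)" .
  have "bounded (c ` (X i \<times> X j))"
    using X c by (intro compact_imp_bounded compact_continuous_image compact_Times)
  then show "\<exists>B. \<forall>x\<in>space (path_space I X). norm (c (x i, x j)) \<le> B"
    unfolding bounded_iff using in_prod by blast
qed

text \<open>Each summand sees only two consecutive coordinates, so the twofold projection preserves
  its integral. Boundedness allows the sum to be split.\<close>

lemma integral_pair_cost_sum:
  fixes X :: "nat \<Rightarrow> 'a::euclidean_space set" and c :: "nat \<Rightarrow> 'a \<times> 'a \<Rightarrow> real"
  assumes X: "\<forall>i\<in>{m..n}. compact (X i)"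
    and c: "\<forall>i\<in>{m..<n}. continuous_on (X i \<times> X (Suc i)) (c i)"
    and \<pi>: "\<pi> \<in> space (prob_algebra (path_space {m..n} X))"
  shows "(LINT x|\<pi>. (\<Sum>i\<in>{m..<n}. c i (x i, x (Suc i))))
      = (\<Sum>i\<in>{m..<n}. (LINT x|Proj {i..Suc i} X \<pi>. c i (x i, x (Suc i))))"
proof -
  have p: "prob_space \<pi>" and s: "sets \<pi> = sets (path_space {m..n} X)" using \<pi> by (auto simp: space_prob_algebra)
  interpret prob_space \<pi> by fact
  have "integrable \<pi> (\<lambda>x. c i (x i, x (Suc i)))" if i: "i \<in> {m..<n}" for i
  proof -
    have ii: "i \<in> {m..n}" "Suc i \<in> {m..n}" using i by auto
    note C = pair_cost_measurable_bounded[OF ii X[rule_format, OF ii(1)] X[rule_format, OF ii(2)] c[rule_format, OF i]]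
    obtain B where "\<forall>x\<in>space (path_space {m..n} X). norm (c i (x i, x (Suc i))) \<le> B" using C(2) by blast
    then have "AE x in \<pi>. norm (c i (x i, x (Suc i))) \<le> B"
      using sets_eq_imp_space_eq[OF s] by (intro AE_I2) auto
    then show ?thesis
      using C(1) by (intro integrable_const_bound) (auto simp: measurable_cong_sets[OF s refl])
  qed
  then have "(LINT x|\<pi>. (\<Sum>i\<in>{m..<n}. c i (x i, x (Suc i)))) = (\<Sum>i\<in>{m..<n}. (LINT x|\<pi>. c i (x i, x (Suc i))))"
    by (intro Bochner_Integration.integral_sum) auto
  also have "\<dots> = (\<Sum>i\<in>{m..<n}. (LINT x|Proj {i..Suc i} X \<pi>. c i (x i, x (Suc i))))"
  proof (rule sum.cong[OF refl])
    fix i assume i: "i \<in> {m..<n}"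
    have ii: "i \<in> {i..Suc i}" "Suc i \<in> {i..Suc i}" "{i..Suc i} \<subseteq> {m..n}" "i \<in> {m..n}" "Suc i \<in> {m..n}" using i by auto
    have "(LINT x|Proj {i..Suc i} X \<pi>. c i (x i, x (Suc i)))
        = (LINT x|\<pi>. c i (restrict x {i..Suc i} i, restrict x {i..Suc i} (Suc i)))"
      by (rule integral_Proj[OF \<pi> ii(3) pair_cost_measurable_bounded(1)[OF ii(1,2)
            X[rule_format, OF ii(4)] X[rule_format, OF ii(5)] c[rule_format, OF i]]])
    then show "(LINT x|\<pi>. c i (x i, x (Suc i))) = (LINT x|Proj {i..Suc i} X \<pi>. c i (x i, x (Suc i)))"
      by simp
  qed
  finally show ?thesis .
qed

section \<open>Projection and gluing\<close>

text \<open>An event in the coordinates \<open>{a..i}\<close> is also an event in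
  \<open>{m..i}\<close>, so increments that are centred given the longer past are centred given the
  shorter one.\<close>

lemma Proj_martingale_coupling:
  fixes X :: "nat \<Rightarrow> 'a::euclidean_space set"
  assumes X: "\<forall>j\<in>{m..n}. compact (X j)" and \<pi>: "\<pi> \<in> martingale_couplings m n X \<mu>"
    and ab: "m \<le> a" "b \<le> n"
  shows "Proj {a..b} X \<pi> \<in> martingale_couplings a b X \<mu>"
proof (rule martingale_couplingI)
  have sub: "{a..b} \<subseteq> {m..n}" using ab by auto
  note \<pi>' = martingale_coupling_space[OF \<pi>]
  show "\<forall>j\<in>{a..b}. compact (X j)" using X sub by auto
  show "Proj {a..b} X \<pi> \<in> couplings a b X \<mu>"
    unfolding couplings_def
  proof (intro CollectI conjI ballI Proj_space[OF \<pi>' sub])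
    fix i assume i: "i \<in> {a..b}"
    have "distr (Proj {a..b} X \<pi>) (borel_on (X i)) (\<lambda>x. x i) = distr \<pi> (borel_on (X i)) (\<lambda>x. x i)"
      using distr_Proj[OF \<pi>' sub measurable_path_coord[OF i]] i by simp
    then show "distr (Proj {a..b} X \<pi>) (borel_on (X i)) (\<lambda>x. x i) = \<mu> i"
      using martingale_coupling_marginal[OF \<pi>] i sub by auto
  qed
  fix i A assume i: "i \<in> {a..<b}" and A: "A \<in> sets (path_space {a..i} X)"
  have ii: "{a..i} \<subseteq> {a..b}" "i \<in> {a..b}" "Suc i \<in> {a..b}" "{a..i} \<subseteq> {m..i}" "i \<in> {m..<n}"
    using i ab by auto
  note [measurable] = A measurable_path_restrict[OF ii(1)] measurable_path_restrict[OF ii(4)]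
    borel_measurable_path_coord[OF ii(2)] borel_measurable_path_coord[OF ii(3)]
  have "(LINT x|Proj {a..b} X \<pi>. (indicator A (restrict x {a..i}) :: real) *\<^sub>R (x (Suc i) - x i))
      = (LINT x|\<pi>. (indicator A (restrict (restrict x {a..b}) {a..i}) :: real) *\<^sub>R
          (restrict x {a..b} (Suc i) - restrict x {a..b} i))"
    by (rule integral_Proj[OF \<pi>' sub]) measurable
  also have "\<dots> = (LINT x|\<pi>. (indicator A (restrict (restrict x {m..i}) {a..i}) :: real) *\<^sub>R (x (Suc i) - x i))"
    using ii(1-4) by (simp add: Int_absorb1)
  also have "\<dots> = 0"
    by (rule martingale_couplingD[OF X \<pi> ii(5) measurable_compose[OF measurable_path_restrict[OF ii(4)]
          borel_measurable_indicator[OF A]], where C=1]) (simp add: indicator_def)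
  finally show "(LINT x|Proj {a..b} X \<pi>. (indicator A (restrict x {a..i}) :: real) *\<^sub>R (x (Suc i) - x i)) = 0" .
qed

lemma distr_bind_distr:
  assumes \<nu>: "\<nu> \<in> space (prob_algebra N)" and \<kappa>: "\<kappa> \<in> N \<rightarrow>\<^sub>M prob_algebra M"
    and F: "F \<in> N \<Otimes>\<^sub>M M \<rightarrow>\<^sub>M K" and f: "f \<in> K \<rightarrow>\<^sub>M L"
  shows "distr (\<nu> \<bind> (\<lambda>x. distr (\<kappa> x) K (\<lambda>y. F (x, y)))) L f = \<nu> \<bind> (\<lambda>x. distr (\<kappa> x) L (\<lambda>y. f (F (x, y))))"
proof -
  have s\<nu>: "sets \<nu> = sets N" and p\<nu>: "prob_space \<nu>" using \<nu> by (auto simp: space_prob_algebra)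
  have Kr: "(\<lambda>x. distr (\<kappa> x) K (\<lambda>y. F (x, y))) \<in> N \<rightarrow>\<^sub>M prob_algebra K"
    by (rule measurable_distr_prob_space2[OF \<kappa>]) (use F in simp)
  have "distr (\<nu> \<bind> (\<lambda>x. distr (\<kappa> x) K (\<lambda>y. F (x, y)))) L f
      = \<nu> \<bind> (\<lambda>x. distr (distr (\<kappa> x) K (\<lambda>y. F (x, y))) L f)"
    using measurable_prob_algebraD[OF Kr] measurable_cong_sets[OF s\<nu> refl]
    by (intro distr_bind[OF _ prob_space.not_empty[OF p\<nu>] f]) blast
  also have "\<dots> = \<nu> \<bind> (\<lambda>x. distr (\<kappa> x) L (\<lambda>y. f (F (x, y))))"
  proof (rule bind_cong[OF refl])
    fix x assume "x \<in> space \<nu>"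
    then have x: "x \<in> space N" using sets_eq_imp_space_eq[OF s\<nu>] by simp
    have s: "sets (\<kappa> x) = sets M" using measurable_space[OF \<kappa> x] by (auto simp: space_prob_algebra)
    have "(\<lambda>y. F (x, y)) \<in> \<kappa> x \<rightarrow>\<^sub>M K" using x F by (simp add: measurable_cong_sets[OF s refl])
    then show "distr (distr (\<kappa> x) K (\<lambda>y. F (x, y))) L f = distr (\<kappa> x) L (\<lambda>y. f (F (x, y)))"
      by (simp add: distr_distr[OF f] comp_def)
  qed
  finally show ?thesis .
qed

text \<open>The glued measure makes the times before \<open>k\<close> and after \<open>k\<close>
  conditionally independent given the position at \<open>k\<close>. Both couplings have the marginal
  \<open>\<mu> k\<close> at that time, which makes them compatible.\<close>

lemma glue_martingale_couplings:
  fixes X :: "nat \<Rightarrow> 'a::euclidean_space set"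
  assumes X: "\<forall>j\<in>{a..b}. compact (X j)" and k: "a \<le> k" "k \<le> b"
    and \<sigma>: "\<sigma> \<in> martingale_couplings a k X \<mu>" and \<tau>: "\<tau> \<in> martingale_couplings k b X \<mu>"
  obtains \<pi> where "\<pi> \<in> martingale_couplings a b X \<mu>" "Proj {a..k} X \<pi> = \<sigma>" "Proj {k..b} X \<pi> = \<tau>"
proof -
  let ?N = "borel_on (X k)" and ?M = "path_space {a..<k} X" and ?K = "path_space {a..b} X"
  let ?S = "path_space {a..k} X" and ?T = "path_space {k..b} X"
  note \<sigma>' = martingale_coupling_space[OF \<sigma>] and \<tau>' = martingale_coupling_space[OF \<tau>]
  have p\<sigma>: "prob_space \<sigma>" and s\<sigma>: "sets \<sigma> = sets ?S" and p\<tau>: "prob_space \<tau>" and s\<tau>: "sets \<tau> = sets ?T"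
    using \<sigma>' \<tau>' by (auto simp: space_prob_algebra)
  have ks: "k \<in> {a..k}" "k \<in> {k..b}" "{a..<k} \<subseteq> {a..k}" "{a..k} \<subseteq> {a..b}" "{k..b} \<subseteq> {a..b}" using k by auto
  have U: "(\<lambda>x. x k) \<in> \<sigma> \<rightarrow>\<^sub>M ?N" and V: "(\<lambda>x. restrict x {a..<k}) \<in> \<sigma> \<rightarrow>\<^sub>M ?M"
    using measurable_path_coord[OF ks(1), of X] measurable_path_restrict[OF ks(3), of X]
    by (simp_all add: measurable_cong_sets[OF s\<sigma> refl])
  have borel: "\<forall>j\<in>{a..<k}. X j \<in> sets borel" using X k by (auto intro!: borel_compact)
  obtain L where L: "L \<in> ?N \<rightarrow>\<^sub>M prob_algebra ?M"
    and dis: "distr \<sigma> (?N \<Otimes>\<^sub>M ?M) (\<lambda>x. (x k, restrict x {a..<k}))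
      = distr \<sigma> ?N (\<lambda>x. x k) \<bind> (\<lambda>s. distr (L s) (?N \<Otimes>\<^sub>M ?M) (Pair s))"
    by (rule path_disintegration[OF p\<sigma> borel U V], rule that)
  \<comment> \<open>The attached past depends on the path of \<open>\<tau>\<close> only through its
    position at time \<open>k\<close>.\<close>
  define L' where "L' z = L (z k)" for z
  have L': "L' \<in> ?T \<rightarrow>\<^sub>M prob_algebra ?M"
    unfolding L'_def by (rule measurable_compose[OF measurable_path_coord[OF ks(2), of X] L])
  \<comment> \<open>The arguments are swapped: the path \<open>z\<close> of \<open>\<tau>\<close> is
    the conditioning variable and comes first, whereas \<open>merge\<close> takes the past first.
    Time \<open>k\<close> itself is read from \<open>z\<close>.\<close>
  define F where "F = (\<lambda>(z :: nat \<Rightarrow> 'a, y). merge {a..<k} {k..b} (y, z))"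
  have un: "{a..<k} \<union> {k..b} = {a..b}" and disj: "{a..<k} \<inter> {k..b} = {}" using k by auto
  note [measurable] = measurable_path_merge[OF un, of X]
  have F: "F \<in> ?T \<Otimes>\<^sub>M ?M \<rightarrow>\<^sub>M ?K" unfolding F_def by measurable
  define \<pi> where "\<pi> = \<tau> \<bind> (\<lambda>z. distr (L' z) ?K (\<lambda>y. F (z, y)))"
  have "(\<lambda>z. distr (L' z) ?K (\<lambda>y. F (z, y))) \<in> ?T \<rightarrow>\<^sub>M prob_algebra ?K"
    by (rule measurable_distr_prob_space2[OF L']) (use F in simp)
  then have \<pi>': "\<pi> \<in> space (prob_algebra ?K)"
    unfolding \<pi>_def by (simp add: space_prob_algebra prob_space_bind'[OF \<tau>'] sets_bind'[OF \<tau>'])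
  have sp\<tau>: "z \<in> space ?T" if "z \<in> space \<tau>" for z using that sets_eq_imp_space_eq[OF s\<tau>] by simp
  have pL': "prob_space (L' z)" and sL': "sets (L' z) = sets ?M" if "z \<in> space ?T" for z
    using measurable_space[OF L' that] by (auto simp: space_prob_algebra)

  have "Proj {k..b} X \<pi> = \<tau> \<bind> (\<lambda>z. distr (L' z) ?T (\<lambda>y. restrict (F (z, y)) {k..b}))"
    unfolding Proj_def \<pi>_def by (rule distr_bind_distr[OF \<tau>' L' F measurable_path_restrict[OF ks(5)]])
  also have "\<dots> = \<tau> \<bind> return ?T"
  proof (rule bind_cong[OF refl])
    fix z assume "z \<in> space \<tau>"
    note z = sp\<tau>[OF this]
    interpret L': prob_space "L' z" by (rule pL'[OF z])
    \<comment> \<open>Attaching a past leaves \<open>z\<close> unchanged, so the projected kernel is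
      the point mass at \<open>z\<close>.\<close>
    have "restrict (F (z, y)) {k..b} = z" for y
      using restrict_path[OF z] by (simp add: F_def restrict_merge(2)[OF disj])
    then show "distr (L' z) ?T (\<lambda>y. restrict (F (z, y)) {k..b}) = return ?T z"
      using z by simp
  qed
  also have "\<dots> = \<tau>" by (rule bind_return''[OF s\<tau>])
  finally have P\<tau>: "Proj {k..b} X \<pi> = \<tau>" .

  \<comment> \<open>\<open>G\<close> rebuilds a path of \<open>\<sigma>\<close> from its position at
    \<open>k\<close> and its strict past.\<close>
  define G where "G = (\<lambda>(s :: 'a, y). (\<lambda>i\<in>{a..k}. if i = k then s else y i))"
  have G: "G \<in> ?N \<Otimes>\<^sub>M ?M \<rightarrow>\<^sub>M ?S"
    unfolding G_def case_prod_beta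
  proof (rule measurable_restrict)
    fix i assume i: "i \<in> {a..k}"
    show "(\<lambda>p. if i = k then fst p else snd p i) \<in> ?N \<Otimes>\<^sub>M ?M \<rightarrow>\<^sub>M borel_on (X i)"
    proof (cases "i = k")
      case False
      then have i': "i \<in> {a..<k}" using i by auto
      show ?thesis using measurable_compose[OF measurable_snd measurable_path_coord[OF i', of X]] False by simp
    qed simp
  qed
  have "Proj {a..k} X \<pi> = \<tau> \<bind> (\<lambda>z. distr (L' z) ?S (\<lambda>y. restrict (F (z, y)) {a..k}))"
    unfolding Proj_def \<pi>_def by (rule distr_bind_distr[OF \<tau>' L' F measurable_path_restrict[OF ks(4)]])
  also have "\<dots> = \<tau> \<bind> (\<lambda>z. distr (L (z k)) ?S (\<lambda>y. G (z k, y)))"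
  proof -
    have "restrict (F (z, y)) {a..k} = G (z k, y)" for z y
      using k by (auto simp: F_def G_def fun_eq_iff merge_def)
    then show ?thesis by (simp add: L'_def)
  qed
  also have "\<dots> = distr \<tau> ?N (\<lambda>z. z k) \<bind> (\<lambda>s. distr (L s) ?S (\<lambda>y. G (s, y)))"
  proof (rule bind_distr[symmetric])
    show "(\<lambda>z. z k) \<in> \<tau> \<rightarrow>\<^sub>M ?N"
      using measurable_path_coord[OF ks(2), of X] by (simp add: measurable_cong_sets[OF s\<tau> refl])
    show "(\<lambda>s. distr (L s) ?S (\<lambda>y. G (s, y))) \<in> ?N \<rightarrow>\<^sub>M subprob_algebra ?S"
      by (rule measurable_prob_algebraD[OF measurable_distr_prob_space2[OF L]]) (use G in simp)
  qed (rule prob_space.not_empty[OF p\<tau>])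
  \<comment> \<open>Here the common marginal at time \<open>k\<close> lets \<open>\<sigma>\<close>
    take the place of \<open>\<tau>\<close>.\<close>
  also have "distr \<tau> ?N (\<lambda>z. z k) = distr \<sigma> ?N (\<lambda>x. x k)"
    using martingale_coupling_marginal[OF \<sigma> ks(1)] martingale_coupling_marginal[OF \<tau> ks(2)] by simp
  also have "\<dots> \<bind> (\<lambda>s. distr (L s) ?S (\<lambda>y. G (s, y))) = distr \<sigma> ?S (\<lambda>x. G (x k, restrict x {a..<k}))"
    by (rule distr_disintegration[OF p\<sigma> U V L dis G, symmetric])
  also have "\<dots> = distr \<sigma> ?S (\<lambda>x. x)"
  proof (rule distr_cong)
    fix x assume "x \<in> space \<sigma>"
    then have "restrict x {a..k} = x" using sets_eq_imp_space_eq[OF s\<sigma>] restrict_path[of x "{a..k}" X] by simp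
    moreover have "G (x k, restrict x {a..<k}) = restrict x {a..k}"
      by (auto simp: G_def fun_eq_iff)
    ultimately show "G (x k, restrict x {a..<k}) = x" by simp
  qed simp_all
  also have "\<dots> = \<sigma>" by (rule distr_id2) (simp add: s\<sigma>)
  finally have P\<sigma>: "Proj {a..k} X \<pi> = \<sigma>" .

  have "\<pi> \<in> martingale_couplings a b X \<mu>"
  proof (rule martingale_couplingI[OF X])
    show "\<pi> \<in> couplings a b X \<mu>"
      unfolding couplings_def
    proof (intro CollectI conjI ballI \<pi>')
      fix i assume i: "i \<in> {a..b}"
      show "distr \<pi> (borel_on (X i)) (\<lambda>x. x i) = \<mu> i"
      proof (cases "i \<le> k")
        case True
        then have i': "i \<in> {a..k}" using i by simp
        then show ?thesis
          using distr_Proj[OF \<pi>' ks(4) measurable_path_coord[OF i']] martingale_coupling_marginal[OF \<sigma> i']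
          by (simp add: P\<sigma>)
      next
        case False
        then have i': "i \<in> {k..b}" using i by simp
        then show ?thesis
          using distr_Proj[OF \<pi>' ks(5) measurable_path_coord[OF i']] martingale_coupling_marginal[OF \<tau> i']
          by (simp add: P\<tau>)
      qed
    qed
    fix i A assume i: "i \<in> {a..<b}" and A[measurable]: "A \<in> sets (path_space {a..i} X)"
    show "(LINT x|\<pi>. (indicator A (restrict x {a..i}) :: real) *\<^sub>R (x (Suc i) - x i)) = 0"
    \<comment> \<open>For \<open>i < k\<close> the increment and its past are seen by
      \<open>\<sigma>\<close>. From \<open>i = k\<close> on the increment is one of
      \<open>\<tau>\<close>, but the past also contains attached coordinates.\<close>
    proof (cases "i < k")
      case True
      then have ii: "{a..i} \<subseteq> {a..k}" "i \<in> {a..k}" "Suc i \<in> {a..k}" "i \<in> {a..<k}" using i by auto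
      note [measurable] = measurable_path_restrict[OF ii(1), of X]
        borel_measurable_path_coord[OF ii(2), of X] borel_measurable_path_coord[OF ii(3), of X]
      have "(LINT x|\<sigma>. (indicator A (restrict x {a..i}) :: real) *\<^sub>R (x (Suc i) - x i))
          = (LINT x|\<pi>. (indicator A (restrict (restrict x {a..k}) {a..i}) :: real) *\<^sub>R
              (restrict x {a..k} (Suc i) - restrict x {a..k} i))"
        unfolding P\<sigma>[symmetric] by (rule integral_Proj[OF \<pi>' ks(4)]) measurable
      also have "\<dots> = (LINT x|\<pi>. (indicator A (restrict x {a..i}) :: real) *\<^sub>R (x (Suc i) - x i))"
        using ii(1-3) by (simp add: Int_absorb1)
      finally have "(LINT x|\<pi>. (indicator A (restrict x {a..i}) :: real) *\<^sub>R (x (Suc i) - x i))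
          = (LINT x|\<sigma>. (indicator A (restrict x {a..i}) :: real) *\<^sub>R (x (Suc i) - x i))" by simp
      also have "\<dots> = 0"
        using X k by (intro martingale_couplingD[OF _ \<sigma> ii(4), where C=1]) (auto simp: indicator_def)
      finally show ?thesis .
    next
      case False
      then have ii: "{a..i} \<subseteq> {a..b}" "i \<in> {a..b}" "Suc i \<in> {a..b}" "i \<in> {k..<b}" "k \<in> {k..i}"
        "{a..<k} \<union> {k..i} = {a..i}" "{k..i} \<subseteq> {k..b}" using i k by auto
      obtain B1 B2 where B1: "\<And>x. x \<in> X (Suc i) \<Longrightarrow> norm x \<le> B1" and B2: "\<And>x. x \<in> X i \<Longrightarrow> norm x \<le> B2"
        using compact_imp_bounded[OF X[rule_format, OF ii(3)]] compact_imp_bounded[OF X[rule_format, OF ii(2)]]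
        unfolding bounded_iff by blast
      note [measurable] = measurable_path_restrict[OF ii(1), of X] measurable_path_merge[OF ii(6), of X]
        borel_measurable_path_coord[OF ii(2), of X] borel_measurable_path_coord[OF ii(3), of X]
      \<comment> \<open>For \<open>z k\<close> in \<open>X k\<close> this is the conditional
        probability of \<open>A\<close> given the positions from time \<open>k\<close> to time
        \<open>i\<close>, the attached past being integrated out.\<close>
      let ?w = "\<lambda>z. measure (L (z k)) {y\<in>space ?M. merge {a..<k} {k..i} (y, z) \<in> A}"
      have Li: "(\<lambda>z. L (z k)) \<in> path_space {k..i} X \<rightarrow>\<^sub>M prob_algebra ?M"
        by (rule measurable_compose[OF measurable_path_coord[OF ii(5), of X] L])
      have w: "?w \<in> borel_measurable (path_space {k..i} X)"
      proof (rule measure_measurable_subprob_algebra2[OF _ measurable_prob_algebraD[OF Li]])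
        have "(SIGMA z:space (path_space {k..i} X). {y\<in>space ?M. merge {a..<k} {k..i} (y, z) \<in> A})
            = {p\<in>space (path_space {k..i} X \<Otimes>\<^sub>M ?M). merge {a..<k} {k..i} (snd p, fst p) \<in> A}"
          by (auto simp: space_pair_measure)
        also have "\<dots> \<in> sets (path_space {k..i} X \<Otimes>\<^sub>M ?M)" by measurable
        finally show "(SIGMA z:space (path_space {k..i} X). {y\<in>space ?M. merge {a..<k} {k..i} (y, z) \<in> A})
          \<in> sets (path_space {k..i} X \<Otimes>\<^sub>M ?M)" .
      qed
      \<comment> \<open>truncated since \<open>L (z k)\<close> need not be a probability measure when \<open>z k\<close> is not in \<open>X k\<close>\<close>
      define w where "w z = max 0 (min 1 (?w z))" for z
      have w_m: "w \<in> borel_measurable (path_space {k..i} X)" unfolding w_def using w by measurable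
      have "(LINT x|\<pi>. (indicator A (restrict x {a..i}) :: real) *\<^sub>R (x (Suc i) - x i))
          = (LINT z|\<tau>. LINT y|L' z. (\<lambda>x. (indicator A (restrict x {a..i}) :: real) *\<^sub>R (x (Suc i) - x i)) (F (z, y)))"
        unfolding \<pi>_def
      proof (rule integral_bind_distr[OF \<tau>' L' F])
        show "norm ((indicator A (restrict x {a..i}) :: real) *\<^sub>R (x (Suc i) - x i)) \<le> B1 + B2"
          if x: "x \<in> space ?K" for x
        proof -
          have "norm (x (Suc i) - x i) \<le> B1 + B2"
            using B1[OF space_path_coord[OF x ii(3)]] B2[OF space_path_coord[OF x ii(2)]]
              norm_triangle_ineq4[of "x (Suc i)" "x i"] by linarith
          from this order_trans[OF norm_ge_zero this] show ?thesis by (auto simp: indicator_def)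
        qed
      qed measurable
      \<comment> \<open>The increment depends on \<open>z\<close> alone, so integrating over
        \<open>y\<close> only replaces the indicator by its conditional probability. The truncation
        in \<open>w\<close> has no effect here because \<open>L' z\<close> is a probability
        measure.\<close>
      also have "\<dots> = (LINT z|\<tau>. w (restrict z {k..i}) *\<^sub>R (z (Suc i) - z i))"
      proof (intro Bochner_Integration.integral_cong refl)
        fix z assume "z \<in> space \<tau>"
        note z = sp\<tau>[OF this]
        interpret L': prob_space "L' z" by (rule pL'[OF z])
        have sp: "space (L' z) = space ?M" by (rule sets_eq_imp_space_eq[OF sL'[OF z]])
        have zi: "restrict z {k..i} \<in> space (path_space {k..i} X)"
          using measurable_space[OF measurable_path_restrict[OF ii(7), of X] z] .
        let ?D = "{y\<in>space ?M. merge {a..<k} {k..i} (y, z) \<in> A}"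
        have "?D = {y\<in>space ?M. merge {a..<k} {k..i} (y, restrict z {k..i}) \<in> A}" by simp
        also have "\<dots> \<in> sets ?M" using zi by measurable
        finally have D: "?D \<in> sets (L' z)" by (simp add: sL'[OF z])
        have "restrict (F (z, y)) {a..i} = merge {a..<k} {k..i} (y, z)" for y
          using ii(4) k by (auto simp: F_def merge_def fun_eq_iff)
        moreover have "F (z, y) (Suc i) = z (Suc i)" "F (z, y) i = z i" for y
          using ii(4) by (simp_all add: F_def merge_def)
        ultimately have "(LINT y|L' z. (indicator A (restrict (F (z, y)) {a..i}) :: real) *\<^sub>R (F (z, y) (Suc i) - F (z, y) i))
            = (LINT y|L' z. indicat_real ?D y *\<^sub>R (z (Suc i) - z i))"
          by (intro Bochner_Integration.integral_cong refl) (simp add: indicator_def sp)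
        also have "\<dots> = measure (L' z) ?D *\<^sub>R (z (Suc i) - z i)"
          using D by (simp add: L'.emeasure_eq_measure)
        also have "measure (L' z) ?D = w (restrict z {k..i})"
          using ii(5) L'.prob_le_1[of ?D] by (simp add: w_def L'_def)
        finally show "(LINT y|L' z. (indicator A (restrict (F (z, y)) {a..i}) :: real) *\<^sub>R (F (z, y) (Suc i) - F (z, y) i))
            = w (restrict z {k..i}) *\<^sub>R (z (Suc i) - z i)" .
      qed
      also have "\<dots> = 0"
        using X k by (intro martingale_couplingD[OF _ \<tau> ii(4) w_m, where C=1]) (auto simp: w_def)
      finally show ?thesis .
    qed
  qed
  from this P\<sigma> P\<tau> show ?thesis by (rule that)
qed

text \<open>Two gluings do it: the past of \<open>\<pi>\<close> up to \<open>i\<close> is joined to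
  \<open>\<rho>\<close> at time \<open>i\<close>, and the result to the future of
  \<open>\<pi>\<close> at time \<open>Suc i\<close>. Every other consecutive pair lies entirely
  within one of the two blocks kept from \<open>\<pi>\<close>. A block may consist of a single
  time.\<close>

lemma replace_two_period_marginal:
  fixes X :: "nat \<Rightarrow> 'a::euclidean_space set"
  assumes X: "\<forall>j\<in>{m..n}. compact (X j)" and \<pi>: "\<pi> \<in> martingale_couplings m n X \<mu>"
    and i: "i \<in> {m..<n}" and \<rho>: "\<rho> \<in> martingale_couplings i (Suc i) X \<mu>"
  obtains \<pi>' where "\<pi>' \<in> martingale_couplings m n X \<mu>" "Proj {i..Suc i} X \<pi>' = \<rho>"
    "\<And>j. j \<in> {m..<n} - {i} \<Longrightarrow> Proj {j..Suc j} X \<pi>' = Proj {j..Suc j} X \<pi>"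
proof -
  note \<pi>s = martingale_coupling_space[OF \<pi>]
  have sub: "{m..i} \<subseteq> {m..Suc i}" "{i..Suc i} \<subseteq> {m..Suc i}" "{m..i} \<subseteq> {m..n}"
    "{m..Suc i} \<subseteq> {m..n}" "{Suc i..n} \<subseteq> {m..n}"
    using i by auto
  have X': "\<forall>j\<in>{m..Suc i}. compact (X j)" using X sub(4) by blast
  have le: "m \<le> i" "i \<le> Suc i" "i \<le> n" "m \<le> Suc i" "Suc i \<le> n" using i by auto
  obtain \<sigma> where \<sigma>: "\<sigma> \<in> martingale_couplings m (Suc i) X \<mu>"
    and \<sigma>1: "Proj {m..i} X \<sigma> = Proj {m..i} X \<pi>" and \<sigma>2: "Proj {i..Suc i} X \<sigma> = \<rho>"
    by (rule glue_martingale_couplings[OF X' le(1,2) Proj_martingale_coupling[OF X \<pi> le_refl le(3)] \<rho>], rule that)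
  obtain \<pi>' where \<pi>': "\<pi>' \<in> martingale_couplings m n X \<mu>"
    and \<pi>1: "Proj {m..Suc i} X \<pi>' = \<sigma>" and \<pi>2: "Proj {Suc i..n} X \<pi>' = Proj {Suc i..n} X \<pi>"
    by (rule glue_martingale_couplings[OF X le(4,5) \<sigma> Proj_martingale_coupling[OF X \<pi> le(4) le_refl]], rule that)
  note \<pi>s' = martingale_coupling_space[OF \<pi>'] and \<sigma>s = martingale_coupling_space[OF \<sigma>]
  have at_i: "Proj {i..Suc i} X \<pi>' = \<rho>"
    using Proj_Proj[OF \<pi>s' sub(4,2)] unfolding \<pi>1 \<sigma>2 by (rule sym)
  have off_i: "Proj {j..Suc j} X \<pi>' = Proj {j..Suc j} X \<pi>" if j: "j \<in> {m..<n} - {i}" for j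
  proof (cases "j < i")
    case True
    then have sub': "{j..Suc j} \<subseteq> {m..i}" using j by auto
    have "Proj {j..Suc j} X \<pi>' = Proj {j..Suc j} X \<sigma>"
      using Proj_Proj[OF \<pi>s' sub(4) order_trans[OF sub' sub(1)]] unfolding \<pi>1 by (rule sym)
    also have "\<dots> = Proj {j..Suc j} X (Proj {m..i} X \<pi>)"
      using Proj_Proj[OF \<sigma>s sub(1) sub'] unfolding \<sigma>1 by (rule sym)
    also have "\<dots> = Proj {j..Suc j} X \<pi>" by (rule Proj_Proj[OF \<pi>s sub(3) sub'])
    finally show ?thesis .
  next
    case False
    then have sub': "{j..Suc j} \<subseteq> {Suc i..n}" using j by auto
    show ?thesis
      using Proj_Proj[OF \<pi>s' sub(5) sub'] Proj_Proj[OF \<pi>s sub(5) sub'] unfolding \<pi>2 by (rule trans[OF sym])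
  qed
  from \<pi>' at_i off_i show ?thesis by (rule that)
qed

theorem proposition2p3:
  fixes n :: nat
    and X :: "nat \<Rightarrow> 'a::euclidean_space set"
    and \<mu> :: "nat \<Rightarrow> 'a measure"
    and c :: "nat \<Rightarrow> 'a \<times> 'a \<Rightarrow> real"
  assumes "n \<ge> 1"
    and "\<forall>i\<in>{1..n}. compact (X i)"
    and "\<forall>i\<in>{1..n}. \<mu> i \<in> space (prob_algebra (borel_on (X i)))"
    and "\<forall>i\<in>{1..<n}. \<mu> i \<preceq>\<^sub>c \<mu> (Suc i)"
    and "\<forall>i\<in>{1..<n}. continuous_on (X i \<times> X (Suc i)) (c i)"
  shows
    "(\<forall>\<pi>2 :: nat \<Rightarrow> (nat \<Rightarrow> 'a) measure.
        (\<forall>i\<in>{1..<n}. mot_optimal i (Suc i) X \<mu> (\<lambda>x. c i (x i, x (Suc i))) (\<pi>2 i)) \<longrightarrow>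
        (\<forall>\<pi>\<in>martingale_couplings 1 n X \<mu>.
          (\<forall>i\<in>{1..<n}. Proj {i..Suc i} X \<pi> = \<pi>2 i) \<longrightarrow>
          mot_optimal 1 n X \<mu> (\<lambda>x. \<Sum>i\<in>{1..<n}. c i (x i, x (Suc i))) \<pi>)) \<and>
     (\<forall>\<pi>. mot_optimal 1 n X \<mu> (\<lambda>x. \<Sum>i\<in>{1..<n}. c i (x i, x (Suc i))) \<pi> \<longrightarrow>
        (\<forall>i\<in>{1..<n}.
          mot_optimal i (Suc i) X \<mu> (\<lambda>x. c i (x i, x (Suc i))) (Proj {i..Suc i} X \<pi>)))"
proof (intro conjI allI impI ballI)
  note X = assms(2)
  note cost = integral_pair_cost_sum[OF X assms(5) martingale_coupling_space]
  have Proj2: "Proj {i..Suc i} X \<rho> \<in> martingale_couplings i (Suc i) X \<mu>"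
    if "\<rho> \<in> martingale_couplings 1 n X \<mu>" "i \<in> {1..<n}" for \<rho> i
    using that(2) by (intro Proj_martingale_coupling[OF X that(1)]) auto
  {
    fix \<pi>2 and \<pi>
    assume opt: "\<forall>i\<in>{1..<n}. mot_optimal i (Suc i) X \<mu> (\<lambda>x. c i (x i, x (Suc i))) (\<pi>2 i)"
      and \<pi>: "\<pi> \<in> martingale_couplings 1 n X \<mu>"
      and proj: "\<forall>i\<in>{1..<n}. Proj {i..Suc i} X \<pi> = \<pi>2 i"
    show "mot_optimal 1 n X \<mu> (\<lambda>x. \<Sum>i\<in>{1..<n}. c i (x i, x (Suc i))) \<pi>"
      unfolding mot_optimal_def
    proof (intro conjI ballI \<pi>)
      fix \<rho> assume \<rho>: "\<rho> \<in> martingale_couplings 1 n X \<mu>"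
      show "(LINT x|\<pi>. (\<Sum>i\<in>{1..<n}. c i (x i, x (Suc i)))) \<le> (LINT x|\<rho>. (\<Sum>i\<in>{1..<n}. c i (x i, x (Suc i))))"
        \<comment> \<open>The costs are compared term by term: each twofold projection of
          \<open>\<rho>\<close> competes with \<open>\<pi>2 i\<close>.\<close>
        unfolding cost[OF \<pi>] cost[OF \<rho>]
        using opt proj Proj2[OF \<rho>] by (intro sum_mono) (simp add: mot_optimal_def)
    qed
  next
    fix \<pi> i
    assume opt: "mot_optimal 1 n X \<mu> (\<lambda>x. \<Sum>i\<in>{1..<n}. c i (x i, x (Suc i))) \<pi>" and i: "i \<in> {1..<n}"
    then have \<pi>: "\<pi> \<in> martingale_couplings 1 n X \<mu>" by (simp add: mot_optimal_def)
    show "mot_optimal i (Suc i) X \<mu> (\<lambda>x. c i (x i, x (Suc i))) (Proj {i..Suc i} X \<pi>)"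
      unfolding mot_optimal_def
    proof (intro conjI ballI Proj2[OF \<pi> i])
      fix \<rho> assume \<rho>: "\<rho> \<in> martingale_couplings i (Suc i) X \<mu>"
      obtain \<pi>' where \<pi>': "\<pi>' \<in> martingale_couplings 1 n X \<mu>" and at_i: "Proj {i..Suc i} X \<pi>' = \<rho>"
        and off_i: "\<And>j. j \<in> {1..<n} - {i} \<Longrightarrow> Proj {j..Suc j} X \<pi>' = Proj {j..Suc j} X \<pi>"
        by (rule replace_two_period_marginal[OF X \<pi> i \<rho>], rule that)
      have "(LINT x|\<pi>. (\<Sum>i\<in>{1..<n}. c i (x i, x (Suc i)))) \<le> (LINT x|\<pi>'. (\<Sum>i\<in>{1..<n}. c i (x i, x (Suc i))))"
        using opt \<pi>' by (simp add: mot_optimal_def)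
      then show "(LINT x|Proj {i..Suc i} X \<pi>. c i (x i, x (Suc i))) \<le> (LINT x|\<rho>. c i (x i, x (Suc i)))"
        \<comment> \<open>All terms except the one at \<open>i\<close> agree for
          \<open>\<pi>\<close> and \<open>\<pi>'\<close> and cancel.\<close>
        unfolding cost[OF \<pi>] cost[OF \<pi>'] using i by (simp add: sum.remove at_i off_i)
    qed
  }
qed

end
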